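(* Let $d\ge 1$ and let $\mathbb{B}_1$ be the open unit ball of $\mathbb{R}^d$. Let $J$ be an open interval in $\mathbb{R}$ containing $0$ and let $g\in C^2(J)$ be a non-negative and non-increasing function with $g(0)>0$. Let $B>0$ and $T>0$ be two real numbers. Then there exists $\lambda_*\in(0,\infty]$ such that, for any $\lambda\in(0,\lambda_* )$, the boundary value problem $$B\Delta^2 u - T\Delta u = -\lambda g(u) \ \text{ in } \mathbb{B}_1, \qquad u=\partial_n u=0 \ \text{ on } \partial\mathbb{B}_1, \qquad (P_\lambda)$$ has a unique radially symmetric and non-positive classical maximal solution $u_\lambda\in C^4(\mathbb{B}_1)\cap C^2(\bar{\mathbb{B}}_1)$ such that $u_\lambda(\bar{\mathbb{B}}_1)\subset J$. If $\lambda_*<\infty$, then $(P_\lambda)$ has no radially symmetric classical solution for $\lambda>\lambda_*$. In addition, for each $x\in\mathbb{B}_1$, the function $\lambda\mapsto u_\lambda(x)$ is decreasing in $(0,\lambda_* )$. Furthermore, if $a:=\inf J>-\infty$ and $m:=\inf_{(a,0)} g>0$, then $\lambda_*<\infty$.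
   Context: $\partial_n u$ denotes the outward normal derivative of $u$ on $\partial\mathbb{B}_1$. A classical solution of $(P_\lambda)$ is a function $u\in C^4(\mathbb{B}_1)\cap C^2(\bar{\mathbb{B}}_1)$ with $u(\bar{\mathbb{B}}_1)\subset J$ satisfying $(P_\lambda)$ pointwise. A radially symmetric classical subsolution of $(P_\lambda)$ is a radially symmetric function $\sigma\in C^4(\mathbb{B}_1)\cap C^2(\bar{\mathbb{B}}_1)$ with $\sigma(\bar{\mathbb{B}}_1)\subset J$ such that $B\Delta^2\sigma-T\Delta\sigma\le-\lambda g(\sigma)$ in $\mathbb{B}_1$ and $\sigma=\partial_n\sigma=0$ on $\partial\mathbb{B}_1$. A radially symmetric classical solution $u_\lambda$ is called maximal if it lies above every radially symmetric classical subsolution, i.e. $\sigma\le u_\lambda$ in $\mathbb{B}_1$ for every such $\sigma$. *)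

theory Defs
  imports "HOL-Analysis.Analysis"
begin

definition partial_deriv :: "'a::euclidean_space \<Rightarrow> ('a \<Rightarrow> real) \<Rightarrow> 'a \<Rightarrow> real" where
  "partial_deriv b u x = frechet_derivative u (at x) b"

definition partial_derivs :: "'a::euclidean_space list \<Rightarrow> ('a \<Rightarrow> real) \<Rightarrow> 'a \<Rightarrow> real" where
  "partial_derivs bs u = foldr partial_deriv bs u"

text \<open>The class C^k(U) for open U. Functions are total; only their values on U matter.
  Differentiability of all partial derivatives of order less than k guarantees that
  the partial derivatives of order at most k are genuine ones.\<close>

definition C_on :: "nat \<Rightarrow> 'a::euclidean_space set \<Rightarrow> ('a \<Rightarrow> real) \<Rightarrow> bool" where
  "C_on k U u \<longleftrightarrow>
     (\<forall>bs. set bs \<subseteq> Basis \<and> length bs < k \<longrightarrow>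
        (\<forall>x\<in>U. partial_derivs bs u differentiable (at x))) \<and>
     (\<forall>bs. set bs \<subseteq> Basis \<and> length bs \<le> k \<longrightarrow> continuous_on U (partial_derivs bs u))"

text \<open>The class C^k of the closure of an open set U: all partial derivatives of order at most k,
  taken in U, extend continuously to the closure, and the values of u on the boundary are those
  of its own continuous extension.\<close>

definition C_closure :: "nat \<Rightarrow> 'a::euclidean_space set \<Rightarrow> ('a \<Rightarrow> real) \<Rightarrow> bool" where
  "C_closure k U u \<longleftrightarrow>
     C_on k U u \<and> continuous_on (closure U) u \<and>
     (\<forall>bs. set bs \<subseteq> Basis \<and> length bs \<le> k \<longrightarrow>
        (\<exists>h. continuous_on (closure U) h \<and> (\<forall>x\<in>U. h x = partial_derivs bs u x)))"

definition laplacian :: "('a::euclidean_space \<Rightarrow> real) \<Rightarrow> 'a \<Rightarrow> real" where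
  "laplacian u x = (\<Sum>b\<in>Basis. partial_deriv b (partial_deriv b u) x)"

definition bilaplacian :: "('a::euclidean_space \<Rightarrow> real) \<Rightarrow> 'a \<Rightarrow> real" where
  "bilaplacian u = laplacian (laplacian u)"

text \<open>The outward normal derivative at a point x of the unit sphere, where the outward unit
  normal is x itself. It is a one-sided derivative from inside the ball, since u is only
  meaningful on the closed ball.\<close>

definition has_normal_derivative :: "('a::euclidean_space \<Rightarrow> real) \<Rightarrow> real \<Rightarrow> 'a \<Rightarrow> bool" where
  "has_normal_derivative u D x \<longleftrightarrow>
     ((\<lambda>t. u (x + t *\<^sub>R x)) has_real_derivative D) (at 0 within {..0})"

definition clamped :: "('a::euclidean_space \<Rightarrow> real) \<Rightarrow> bool" where
  "clamped u \<longleftrightarrow> (\<forall>x\<in>sphere 0 1. u x = 0 \<and> has_normal_derivative u 0 x)"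

definition radially_symmetric :: "('a::euclidean_space \<Rightarrow> real) \<Rightarrow> bool" where
  "radially_symmetric u \<longleftrightarrow> (\<forall>x\<in>cball 0 1. \<forall>y\<in>cball 0 1. norm x = norm y \<longrightarrow> u x = u y)"

definition classical_solution ::
  "real set \<Rightarrow> (real \<Rightarrow> real) \<Rightarrow> real \<Rightarrow> real \<Rightarrow> real \<Rightarrow> ('a::euclidean_space \<Rightarrow> real) \<Rightarrow> bool" where
  "classical_solution J g B T l u \<longleftrightarrow>
     C_on 4 (ball 0 1) u \<and> C_closure 2 (ball 0 1) u \<and> u ` cball 0 1 \<subseteq> J \<and>
     (\<forall>x\<in>ball 0 1. B * bilaplacian u x - T * laplacian u x = - l * g (u x)) \<and>
     clamped u"

definition radial_classical_subsolution ::
  "real set \<Rightarrow> (real \<Rightarrow> real) \<Rightarrow> real \<Rightarrow> real \<Rightarrow> real \<Rightarrow> ('a::euclidean_space \<Rightarrow> real) \<Rightarrow> bool" where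
  "radial_classical_subsolution J g B T l s \<longleftrightarrow>
     radially_symmetric s \<and>
     C_on 4 (ball 0 1) s \<and> C_closure 2 (ball 0 1) s \<and> s ` cball 0 1 \<subseteq> J \<and>
     (\<forall>x\<in>ball 0 1. B * bilaplacian s x - T * laplacian s x \<le> - l * g (s x)) \<and>
     clamped s"

definition maximal_solution ::
  "real set \<Rightarrow> (real \<Rightarrow> real) \<Rightarrow> real \<Rightarrow> real \<Rightarrow> real \<Rightarrow> ('a::euclidean_space \<Rightarrow> real) \<Rightarrow> bool" where
  "maximal_solution J g B T l u \<longleftrightarrow>
     radially_symmetric u \<and> classical_solution J g B T l u \<and>
     (\<forall>s. radial_classical_subsolution J g B T l s \<longrightarrow> (\<forall>x\<in>ball 0 1. s x \<le> u x))"

definition nonpositive_maximal_solution ::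
  "real set \<Rightarrow> (real \<Rightarrow> real) \<Rightarrow> real \<Rightarrow> real \<Rightarrow> real \<Rightarrow> ('a::euclidean_space \<Rightarrow> real) \<Rightarrow> bool" where
  "nonpositive_maximal_solution J g B T l u \<longleftrightarrow>
     maximal_solution J g B T l u \<and> (\<forall>x\<in>cball 0 1. u x \<le> 0)"

end

theory Submission imports Defs begin

text \<open>
  Radial functions turn the clamped plate problem into a problem in one variable. The left-hand side
  factors as (B Laplacian - T) applied to w = Laplacian u, so a radial profile \<open>\<phi>(r)\<close> comes with
  its flux P = r^n \<open>\<phi>'\<close>, the profile w of its Laplacian and the flux Q = r^n w', where n + 1 is the
  dimension. The flux P vanishes at the centre, and the condition on the normal derivative says that
  it vanishes at r = 1 as well, that is, that w has mean zero over the ball.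

  Everything rests on a comparison principle (\<open>plate_nonpos\<close>, \<open>plate_le\<close>): a non-positive right-hand
  side forces \<open>\<phi> \<le> 0\<close>. The reason is that w cannot pass from negative to positive values as r grows
  (\<open>no_negative_to_positive\<close>). Since w has mean zero, it is first non-negative and then
  non-positive, so P is non-negative and \<open>\<phi>\<close> increases to its boundary value 0.

  The linear problem is solved explicitly (locale \<open>green_operator\<close>). In the variable t = |x|^2 the
  equation for w is solved by reduction of order from a positive solution of the homogeneous
  equation, given by a power series, and u' is an average of w. The averages preserve one-sided
  smoothness in t up to t = 0, so the Green operator gains two derivatives in t, and no
  singularity appears at the centre of the ball (\<open>green_Ck\<close>, \<open>radial_C_on\<close>).

  As g is non-increasing, v \<open>\<mapsto>\<close> Green(- l g(v)) is monotone, a subsolution lies below its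
  image by comparison, and the supremum of all functions below their image is the largest fixed point,
  as in the Knaster-Tarski theorem (\<open>greatest_fixed_point\<close>). One subsolution is enough to start this
  argument, and the fixed point is then the maximal solution. Two applications of the Green operator
  make a continuous fixed point C^4, because g is C^2.

  A subsolution for one load is a subsolution for every smaller load, so the loads l that admit a
  subsolution form an interval; its right end is the critical load. Small constants on the
  right-hand side give a subsolution, so the interval is not empty. Strict monotonicity in l is the
  strict comparison principle \<open>plate_neg\<close>, and if J is bounded below by a and g is at least m > 0
  on (a, 0), every subsolution lies below l m Green(-1), whose value at 0 would fall below a for large l.
\<close>

section \<open>Iterated partial derivatives\<close>

lemma partial_derivs_snoc: "partial_derivs (bs @ [b]) u = partial_derivs bs (partial_deriv b u)"
  by (simp add: partial_derivs_def)

lemma C_on_0: "C_on 0 U u \<longleftrightarrow> continuous_on U u"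
  by (auto simp: C_on_def partial_derivs_def)

text \<open>The definition lists all iterated partial derivatives, the outermost one at the head of the list.
  Peeling off the innermost one instead turns C^(k+1) into a recursive notion, on which all closure
  properties below are proved by induction.\<close>
lemma C_on_Suc:
  fixes u :: "'a::euclidean_space \<Rightarrow> real"
  shows "C_on (Suc k) U u \<longleftrightarrow>
     (\<forall>x\<in>U. u differentiable (at x)) \<and> (\<forall>b\<in>Basis. C_on k U (partial_deriv b u))"
proof
  assume u: "C_on (Suc k) U u"
  have "u differentiable (at x)" if "x \<in> U" for x
    using conjunct1[OF u[unfolded C_on_def], rule_format, of "[]"] that by (simp add: partial_derivs_def)
  moreover have "C_on k U (partial_deriv b u)" if "b \<in> Basis" for b
    using u that unfolding C_on_def partial_derivs_snoc[symmetric] by auto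
  ultimately show "(\<forall>x\<in>U. u differentiable (at x)) \<and> (\<forall>b\<in>Basis. C_on k U (partial_deriv b u))"
    by blast
next
  assume u: "(\<forall>x\<in>U. u differentiable (at x)) \<and> (\<forall>b\<in>Basis. C_on k U (partial_deriv b u))"
  have cu: "continuous_on U u"
    using u by (meson continuous_at_imp_continuous_on differentiable_imp_continuous_within)
  show "C_on (Suc k) U u"
    unfolding C_on_def
  proof (intro conjI allI impI ballI)
    fix bs :: "'a list" and x assume bs: "set bs \<subseteq> Basis \<and> length bs < Suc k" and x: "x \<in> U"
    show "partial_derivs bs u differentiable (at x)"
    proof (cases bs rule: rev_cases)
      case Nil then show ?thesis using u x by (simp add: partial_derivs_def)
    next
      case (snoc cs c)
      then show ?thesis using u x bs by (auto simp: partial_derivs_snoc C_on_def)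
    qed
  next
    fix bs :: "'a list" assume bs: "set bs \<subseteq> Basis \<and> length bs \<le> Suc k"
    show "continuous_on U (partial_derivs bs u)"
    proof (cases bs rule: rev_cases)
      case Nil then show ?thesis using cu by (simp add: partial_derivs_def)
    next
      case (snoc cs c)
      then show ?thesis using u bs by (auto simp: partial_derivs_snoc C_on_def)
    qed
  qed
qed

lemma C_on_imp_continuous: "C_on k U u \<Longrightarrow> continuous_on U u"
  unfolding C_on_def by (drule conjunct2, drule spec[of _ "[]"]) (simp add: partial_derivs_def)

lemma C_on_SucD: "C_on (Suc k) U u \<Longrightarrow> C_on k U u"
  unfolding C_on_def by auto

lemma partial_deriv_eq:
  assumes "(u has_derivative D) (at x)"
  shows "partial_deriv b u x = D b"
  using frechet_derivative_at[OF assms] by (simp add: partial_deriv_def)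

lemma partial_deriv_cong:
  assumes "open U" "x \<in> U" "\<And>y. y \<in> U \<Longrightarrow> u y = v y"
  shows "partial_deriv b u x = partial_deriv b v x"
proof -
  have "(u has_derivative D) (at x) \<longleftrightarrow> (v has_derivative D) (at x)" for D
    using assms has_derivative_transform_within_open[of u D x UNIV U v]
      has_derivative_transform_within_open[of v D x UNIV U u] by auto
  then show ?thesis by (simp add: partial_deriv_def frechet_derivative_def)
qed

lemma C_on_cong:
  assumes "open U" "\<And>y. y \<in> U \<Longrightarrow> u y = v y" "C_on k U u"
  shows "C_on k U v"
  using assms
proof (induction k arbitrary: u v)
  case 0
  then show ?case by (metis C_on_0 continuous_on_cong)
next
  case (Suc k)
  have "v differentiable (at x)" if x: "x \<in> U" for x
  proof -
    obtain D where "(u has_derivative D) (at x)"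
      using Suc.prems(3) x by (auto simp: C_on_Suc differentiable_def)
    from has_derivative_transform_within_open[OF this Suc.prems(1) x Suc.prems(2)]
    show ?thesis unfolding differentiable_def by blast
  qed
  moreover have "C_on k U (partial_deriv b v)" if "b \<in> Basis" for b
  proof (rule Suc.IH[of "partial_deriv b u", OF Suc.prems(1)])
    show "partial_deriv b u y = partial_deriv b v y" if "y \<in> U" for y
      using partial_deriv_cong[OF Suc.prems(1) that Suc.prems(2)] .
  qed (use Suc.prems that in \<open>auto simp: C_on_Suc\<close>)
  ultimately show ?case by (simp add: C_on_Suc)
qed

lemma partial_deriv_add:
  assumes "u differentiable (at x)" "v differentiable (at x)"
  shows "partial_deriv b (\<lambda>x. u x + v x) x = partial_deriv b u x + partial_deriv b v x"
  using partial_deriv_eq[OF has_derivative_add[OF assms[unfolded frechet_derivative_works]]]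
  by (simp add: partial_deriv_def)

lemma partial_deriv_mult:
  assumes "u differentiable (at x)" "v differentiable (at x)"
  shows "partial_deriv b (\<lambda>x. u x * v x) x = u x * partial_deriv b v x + partial_deriv b u x * v x"
  using partial_deriv_eq[OF has_derivative_mult[OF assms[unfolded frechet_derivative_works]]]
  by (simp add: partial_deriv_def)

lemma C_on_add:
  assumes "open U" "C_on k U u" "C_on k U v"
  shows "C_on k U (\<lambda>x. u x + v x)"
  using assms
proof (induction k arbitrary: u v)
  case 0
  then show ?case by (auto simp: C_on_0 intro: continuous_on_add)
next
  case (Suc k)
  have "C_on k U (partial_deriv b (\<lambda>x. u x + v x))" if "b \<in> Basis" for b
    by (rule C_on_cong[OF Suc.prems(1) _ Suc.IH[of "partial_deriv b u" "partial_deriv b v"]])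
       (use Suc.prems that in \<open>auto simp: C_on_Suc partial_deriv_add\<close>)
  then show ?case using Suc.prems by (auto simp: C_on_Suc intro: differentiable_add)
qed

lemma C_on_mult:
  assumes "open U" "C_on k U u" "C_on k U v"
  shows "C_on k U (\<lambda>x. u x * v x)"
  using assms
proof (induction k arbitrary: u v)
  case 0
  then show ?case by (auto simp: C_on_0 intro: continuous_on_mult)
next
  case (Suc k)
  have "C_on k U (partial_deriv b (\<lambda>x. u x * v x))" if b: "b \<in> Basis" for b
  proof (rule C_on_cong[OF Suc.prems(1)])
    show "C_on k U (\<lambda>x. u x * partial_deriv b v x + partial_deriv b u x * v x)"
      using Suc.prems b C_on_SucD[OF Suc.prems(2)] C_on_SucD[OF Suc.prems(3)]
      by (intro C_on_add Suc.IH) (auto simp: C_on_Suc)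
  qed (use Suc.prems in \<open>auto simp: C_on_Suc partial_deriv_mult\<close>)
  then show ?case using Suc.prems by (auto simp: C_on_Suc intro: differentiable_mult)
qed

lemma C_on_const: "C_on k U (\<lambda>_. c)"
proof (induction k arbitrary: c)
  case (Suc k)
  have "partial_deriv b (\<lambda>_. c) = (\<lambda>_. 0)" for b :: 'a
    by (simp add: fun_eq_iff partial_deriv_def)
  then show ?case using Suc by (auto simp: C_on_Suc)
qed (simp add: C_on_0)

lemma C_on_sum:
  assumes "open U" "\<And>i. i \<in> A \<Longrightarrow> C_on k U (u i)"
  shows "C_on k U (\<lambda>x. \<Sum>i\<in>A. u i x)"
  using assms(2)
  by (induction A rule: infinite_finite_induct) (auto simp: C_on_const intro!: C_on_add assms(1))

lemma C_on_inner: "C_on k U (\<lambda>x. x \<bullet> b)"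
proof (cases k)
  case (Suc j)
  have "((\<lambda>x. x \<bullet> b) has_derivative (\<lambda>h. h \<bullet> b)) (at x)" for x
    by (auto intro!: derivative_eq_intros)
  then have "partial_deriv c (\<lambda>x. x \<bullet> b) = (\<lambda>_. c \<bullet> b)" for c
    using partial_deriv_eq by blast
  then show ?thesis by (simp add: Suc C_on_Suc C_on_const)
qed (auto simp: C_on_0 intro!: continuous_intros)

lemma C_on_laplacian:
  assumes "open U" "C_on (Suc (Suc k)) U u"
  shows "C_on k U (laplacian u)"
  using C_on_sum[OF assms(1), of Basis k "\<lambda>b. partial_deriv b (partial_deriv b u)"] assms(2)
  by (simp add: C_on_Suc laplacian_def[abs_def])

lemma laplacian_cong:
  assumes "open U" "x \<in> U" "\<And>y. y \<in> U \<Longrightarrow> u y = v y"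
  shows "laplacian u x = laplacian v x"
  unfolding laplacian_def
  by (intro sum.cong refl partial_deriv_cong[OF assms(1,2)] partial_deriv_cong[OF assms(1)]) (auto simp: assms(3))

section \<open>One-sided smoothness on the unit interval and radial functions\<close>

text \<open>Profiles are functions of t = |x|^2, which takes values in the closed unit interval only. The
  derivatives are therefore one-sided at both ends, and no extension to negative t is ever needed.\<close>
primrec Ck :: "nat \<Rightarrow> (real \<Rightarrow> real) \<Rightarrow> bool" where
  "Ck 0 f \<longleftrightarrow> continuous_on {0..1} f"
| "Ck (Suc k) f \<longleftrightarrow> (\<exists>f'. (\<forall>t\<in>{0..1}. (f has_real_derivative f' t) (at t within {0..1})) \<and> Ck k f')"

lemma Ck_SucE:
  assumes "Ck (Suc k) f"
  obtains f' where "\<And>t. t \<in> {0..1} \<Longrightarrow> (f has_real_derivative f' t) (at t within {0..1})" "Ck k f'"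
  using assms unfolding Ck.simps by blast

lemma Ck_antiderivative:
  assumes "\<And>t. t \<in> {0..1} \<Longrightarrow> (F has_real_derivative f t) (at t within {0..1})" "Ck k f"
  shows "Ck (Suc k) F"
  using assms unfolding Ck.simps by blast

lemma Ck_imp_continuous: "Ck k f \<Longrightarrow> continuous_on {0..1} f"
  by (cases k) (auto intro: DERIV_continuous_on)

lemma Ck_SucD: "Ck (Suc k) f \<Longrightarrow> Ck k f"
proof (induction k arbitrary: f)
  case 0
  then show ?case using Ck_imp_continuous[of "Suc 0" f] by simp
next
  case (Suc k)
  from Suc.prems obtain f' where
    "\<forall>t\<in>{0..1}. (f has_real_derivative f' t) (at t within {0..1})" "Ck (Suc k) f'"
    by (subst (asm) Ck.simps(2)) blast
  with Suc.IH[of f'] show ?case by auto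
qed

lemma Ck_cong:
  assumes "\<And>t. t \<in> {0..1} \<Longrightarrow> f t = g t" "Ck k f"
  shows "Ck k g"
proof (cases k)
  case 0
  then show ?thesis using assms continuous_on_cong[of "{0..1}" "{0..1}" f g] by simp
next
  case (Suc j)
  then obtain f' where "\<forall>t\<in>{0..1}. (f has_real_derivative f' t) (at t within {0..1})" "Ck j f'"
    using assms by auto
  moreover have "\<forall>t\<in>{0..1}. (g has_real_derivative f' t) (at t within {0..1})"
    using calculation(1) assms(1) unfolding has_field_derivative_def
    by (auto intro: has_derivative_transform[where f = f])
  ultimately show ?thesis using Suc by auto
qed

lemma Ck_const: "Ck k (\<lambda>_. c)"
proof (induction k arbitrary: c)
  case (Suc k)
  show ?case unfolding Ck.simps by (rule exI[of _ "\<lambda>_. 0"]) (use Suc in auto)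
qed simp

lemma Ck_add:
  assumes "Ck k f" "Ck k g"
  shows "Ck k (\<lambda>t. f t + g t)"
  using assms
proof (induction k arbitrary: f g)
  case (Suc k)
  then obtain f' g' where "\<forall>t\<in>{0..1}. (f has_real_derivative f' t) (at t within {0..1})" "Ck k f'"
      "\<forall>t\<in>{0..1}. (g has_real_derivative g' t) (at t within {0..1})" "Ck k g'"
    by auto
  then show ?case unfolding Ck.simps
    by (intro exI[of _ "\<lambda>t. f' t + g' t"]) (auto intro!: Suc.IH derivative_eq_intros)
qed (auto intro: continuous_on_add)

lemma Ck_mult:
  assumes "Ck k f" "Ck k g"
  shows "Ck k (\<lambda>t. f t * g t)"
  using assms
proof (induction k arbitrary: f g)
  case (Suc k)
  then obtain f' g' where "\<forall>t\<in>{0..1}. (f has_real_derivative f' t) (at t within {0..1})" "Ck k f'"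
      "\<forall>t\<in>{0..1}. (g has_real_derivative g' t) (at t within {0..1})" "Ck k g'"
    by auto
  then show ?case unfolding Ck.simps
    using Ck_SucD[OF Suc.prems(1)] Ck_SucD[OF Suc.prems(2)]
    by (intro exI[of _ "\<lambda>t. f' t * g t + g' t * f t"])
       (auto intro!: Ck_add Suc.IH derivative_eq_intros)
qed (auto intro: continuous_on_mult)

lemma Ck_inverse:
  assumes "Ck k f" "\<And>t. t \<in> {0..1} \<Longrightarrow> f t \<noteq> 0"
  shows "Ck k (\<lambda>t. inverse (f t))"
  using assms
proof (induction k arbitrary: f)
  case (Suc k)
  then obtain f' where f': "\<forall>t\<in>{0..1}. (f has_real_derivative f' t) (at t within {0..1})" "Ck k f'"
    by auto
  have "Ck k (\<lambda>t. inverse (f t))" using Ck_SucD[OF Suc.prems(1)] Suc by blast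
  with f' have "Ck k (\<lambda>t. (-1) * (inverse (f t) * f' t * inverse (f t)))"
    by (intro Ck_mult Ck_const)
  then show ?case unfolding Ck.simps using f' Suc.prems(2)
    by (intro exI[of _ "\<lambda>t. (-1) * (inverse (f t) * f' t * inverse (f t))"])
       (auto intro!: derivative_eq_intros)
qed (auto intro!: continuous_on_inverse)

lemma Ck_compose:
  assumes "C_on k J g" "Ck k U" "\<And>t. t \<in> {0..1} \<Longrightarrow> U t \<in> J"
  shows "Ck k (\<lambda>t. g (U t))"
  using assms
proof (induction k arbitrary: g)
  case 0
  then have "continuous_on J g" "continuous_on {0..1} U" "U ` {0..1} \<subseteq> J"
    unfolding C_on_0 Ck.simps by blast+
  from continuous_on_compose2[OF this] show ?case by simp
next
  case (Suc k)
  then obtain U' where U': "\<forall>t\<in>{0..1}. (U has_real_derivative U' t) (at t within {0..1})" "Ck k U'"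
    by auto
  have g: "(g has_real_derivative partial_deriv 1 g s) (at s)" if "s \<in> J" for s
  proof -
    have "g differentiable (at s)" using Suc.prems(1) that by (auto simp: C_on_Suc)
    then obtain D where D: "(g has_real_derivative D) (at s)"
      by (auto simp: real_differentiable_def)
    with partial_deriv_eq[OF D[unfolded has_field_derivative_def], of 1] show ?thesis by simp
  qed
  have "((\<lambda>t. g (U t)) has_real_derivative partial_deriv 1 g (U t) * U' t) (at t within {0..1})"
    if "t \<in> {0..1}" for t
  proof (rule DERIV_chain2[where f = g and g = U])
    show "(g has_real_derivative partial_deriv 1 g (U t)) (at (U t))"
      by (rule g) (rule Suc.prems(3)[OF that])
    show "(U has_real_derivative U' t) (at t within {0..1})"
      using U'(1) that by simp
  qed
  moreover have "Ck k (\<lambda>t. partial_deriv 1 g (U t) * U' t)"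
    by (rule Ck_mult[OF Suc.IH U'(2)])
       (use Suc.prems Ck_SucD[OF Suc.prems(2)] in \<open>auto simp: C_on_Suc\<close>)
  ultimately show ?case
    by (auto intro!: exI[of _ "\<lambda>t. partial_deriv 1 g (U t) * U' t"])
qed

text \<open>The one-sided derivative of U at 0 suffices at the origin, because t = |x|^2 never leaves the unit
  interval. This is what makes the variable |x|^2 preferable to |x|.\<close>
lemma radial_has_derivative:
  fixes x :: "'a::euclidean_space"
  assumes "\<And>t. t \<in> {0..1} \<Longrightarrow> (U has_real_derivative U1 t) (at t within {0..1})" "x \<in> ball 0 1"
  shows "((\<lambda>x. U (x \<bullet> x)) has_derivative (\<lambda>h. U1 (x \<bullet> x) * (2 * (x \<bullet> h)))) (at x)"
proof -
  have sub: "y \<bullet> y \<in> {0..1}" if "y \<in> ball 0 1" for y :: 'a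
    using that by (simp add: dot_square_norm power_le_one)
  have "((\<lambda>x. U (x \<bullet> x)) has_derivative (\<lambda>h. U1 (x \<bullet> x) * (2 * (x \<bullet> h)))) (at x within ball 0 1)"
  proof (rule has_derivative_in_compose2[of "{0..1}" U "\<lambda>t h. U1 t * h" "\<lambda>x. x \<bullet> x" "ball 0 1"])
    show "((\<lambda>x. x \<bullet> x) has_derivative (\<lambda>h. 2 * (x \<bullet> h))) (at x within ball 0 1)"
      by (auto intro!: derivative_eq_intros simp: inner_commute)
  qed (use assms sub in \<open>auto simp: has_field_derivative_def\<close>)
  then show ?thesis using assms(2) by (metis at_within_open open_ball)
qed

lemma radial_partial_deriv:
  fixes x :: "'a::euclidean_space"
  assumes "\<And>t. t \<in> {0..1} \<Longrightarrow> (U has_real_derivative U1 t) (at t within {0..1})" "x \<in> ball 0 1"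
  shows "partial_deriv b (\<lambda>x. U (x \<bullet> x)) x = 2 * (x \<bullet> b) * U1 (x \<bullet> x)"
  using partial_deriv_eq[OF radial_has_derivative[OF assms], of b] by simp

text \<open>Each partial derivative is 2 (x \<open>\<bullet>\<close> b) U'(|x|^2), a product of a polynomial and a radial function of
  the same kind with one derivative less.\<close>
lemma radial_C_on: "Ck k U \<Longrightarrow> C_on k (ball 0 1) (\<lambda>x::'a::euclidean_space. U (x \<bullet> x))"
proof (induction k arbitrary: U)
  case 0
  have "x \<bullet> x \<in> {0..1}" if "x \<in> ball 0 1" for x :: 'a
    using that by (simp add: dot_square_norm power_le_one)
  then show ?case using 0
    by (auto simp: C_on_0 intro!: continuous_intros continuous_on_compose2[of "{0..1}" U])
next
  case (Suc k)
  then obtain U' where U': "\<forall>t\<in>{0..1}. (U has_real_derivative U' t) (at t within {0..1})" "Ck k U'"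
    by auto
  have "C_on k (ball 0 1) (partial_deriv b (\<lambda>x::'a. U (x \<bullet> x)))" for b
  proof (rule C_on_cong)
    show "C_on k (ball 0 1) (\<lambda>x::'a. 2 * (x \<bullet> b) * U' (x \<bullet> x))"
      by (intro C_on_mult C_on_const C_on_inner Suc.IH U') auto
  qed (use U' radial_partial_deriv in \<open>fastforce+\<close>)
  moreover have "(\<lambda>x::'a. U (x \<bullet> x)) differentiable (at x)" if "x \<in> ball 0 1" for x
    using radial_has_derivative[of U U'] U' that unfolding differentiable_def by blast
  ultimately show ?case by (simp add: C_on_Suc)
qed

lemma radial_partial_deriv2:
  fixes x :: "'a::euclidean_space"
  assumes U1: "\<And>t. t \<in> {0..1} \<Longrightarrow> (U has_real_derivative U1 t) (at t within {0..1})"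
    and U2: "\<And>t. t \<in> {0..1} \<Longrightarrow> (U1 has_real_derivative U2 t) (at t within {0..1})"
    and x: "x \<in> ball 0 1"
  shows "partial_deriv c (partial_deriv b (\<lambda>x. U (x \<bullet> x))) x
    = 2 * (c \<bullet> b) * U1 (x \<bullet> x) + 4 * (x \<bullet> b) * (x \<bullet> c) * U2 (x \<bullet> x)"
proof -
  have "partial_deriv c (partial_deriv b (\<lambda>x. U (x \<bullet> x))) x
     = partial_deriv c (\<lambda>x. 2 * (x \<bullet> b) * U1 (x \<bullet> x)) x"
    by (rule partial_deriv_cong[of "ball 0 1"]) (use x U1 radial_partial_deriv in \<open>fastforce+\<close>)
  also have "((\<lambda>x. 2 * (x \<bullet> b) * U1 (x \<bullet> x)) has_derivative
      (\<lambda>h. 2 * (x \<bullet> b) * (U2 (x \<bullet> x) * (2 * (x \<bullet> h))) + 2 * (h \<bullet> b) * U1 (x \<bullet> x))) (at x)"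
    by (auto intro!: derivative_eq_intros radial_has_derivative[OF U2 x])
  from partial_deriv_eq[OF this, of c]
  have "partial_deriv c (\<lambda>x. 2 * (x \<bullet> b) * U1 (x \<bullet> x)) x
    = 2 * (c \<bullet> b) * U1 (x \<bullet> x) + 4 * (x \<bullet> b) * (x \<bullet> c) * U2 (x \<bullet> x)"
    by (simp add: algebra_simps)
  finally show ?thesis .
qed

lemma radial_laplacian:
  fixes x :: "'a::euclidean_space"
  assumes "\<And>t. t \<in> {0..1} \<Longrightarrow> (U has_real_derivative U1 t) (at t within {0..1})"
    and "\<And>t. t \<in> {0..1} \<Longrightarrow> (U1 has_real_derivative U2 t) (at t within {0..1})"
    and "x \<in> ball 0 1"
  shows "laplacian (\<lambda>x. U (x \<bullet> x)) x
    = 4 * (x \<bullet> x) * U2 (x \<bullet> x) + 2 * real DIM('a) * U1 (x \<bullet> x)"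
proof -
  have "laplacian (\<lambda>x. U (x \<bullet> x)) x
    = (\<Sum>b\<in>Basis. 2 * U1 (x \<bullet> x) + 4 * U2 (x \<bullet> x) * ((x \<bullet> b) * (x \<bullet> b)))"
    unfolding laplacian_def using radial_partial_deriv2[OF assms]
    by (intro sum.cong) (auto simp: algebra_simps)
  also have "\<dots> = 4 * (x \<bullet> x) * U2 (x \<bullet> x) + 2 * real DIM('a) * U1 (x \<bullet> x)"
    using euclidean_inner[of x x] by (simp add: sum.distrib flip: sum_distrib_left)
  finally show ?thesis .
qed

text \<open>The formulas for the first and second partial derivatives make sense on the closed ball and
  provide the continuous extensions.\<close>
lemma radial_C_closure:
  assumes "Ck 2 U"
  shows "C_closure 2 (ball 0 1) (\<lambda>x::'a::euclidean_space. U (x \<bullet> x))"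
proof -
  obtain U1 U2 where "\<forall>t\<in>{0..1}. (U has_real_derivative U1 t) (at t within {0..1})"
    "\<forall>t\<in>{0..1}. (U1 has_real_derivative U2 t) (at t within {0..1})"
    and c2: "continuous_on {0..1} U2"
    using assms unfolding numeral_2_eq_2 Ck.simps by blast
  then have U1: "\<And>t. t \<in> {0..1} \<Longrightarrow> (U has_real_derivative U1 t) (at t within {0..1})"
    and U2: "\<And>t. t \<in> {0..1} \<Longrightarrow> (U1 has_real_derivative U2 t) (at t within {0..1})"
    by blast+
  have c1: "continuous_on {0..1} U1" and c0: "continuous_on {0..1} U"
    using U1 U2 DERIV_continuous_on by blast+
  have d1: "partial_deriv b (\<lambda>x. U (x \<bullet> x)) x = 2 * (x \<bullet> b) * U1 (x \<bullet> x)"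
    if "x \<in> ball 0 1" for x b :: 'a
    using radial_partial_deriv[OF U1 that] .
  have d2: "partial_deriv c (partial_deriv b (\<lambda>x. U (x \<bullet> x))) x
    = 2 * (c \<bullet> b) * U1 (x \<bullet> x) + 4 * (x \<bullet> b) * (x \<bullet> c) * U2 (x \<bullet> x)"
    if "x \<in> ball 0 1" for x b c :: 'a
    using radial_partial_deriv2[OF U1 U2 that] .
  have rad: "continuous_on (cball 0 1) (\<lambda>x::'a. V (x \<bullet> x))" if "continuous_on {0..1} V" for V
    using that by (auto intro!: continuous_intros continuous_on_compose2[of "{0..1}" V]
        simp: dot_square_norm power_le_one)
  have "\<exists>h. continuous_on (cball 0 1) h \<and> (\<forall>x\<in>ball 0 1. h x = partial_derivs bs (\<lambda>x. U (x \<bullet> x)) x)"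
    if "length bs \<le> 2" for bs :: "'a list"
  proof -
    consider (0) "bs = []" | (1) b where "bs = [b]" | (2) c b where "bs = [c, b]"
    proof (cases bs)
      case (Cons c cs)
      with that \<open>length bs \<le> 2\<close> show ?thesis by (cases cs) auto
    qed simp
    then show ?thesis
    proof cases
      case 0
      then show ?thesis using rad[OF c0] by (auto simp: partial_derivs_def)
    next
      case (1 b)
      then show ?thesis
        by (intro exI[of _ "\<lambda>x. 2 * (x \<bullet> b) * U1 (x \<bullet> x)"])
           (auto simp: partial_derivs_def d1 intro!: continuous_intros rad c1)
    next
      case (2 c b)
      then show ?thesis
        by (intro exI[of _ "\<lambda>x. 2 * (c \<bullet> b) * U1 (x \<bullet> x) + 4 * (x \<bullet> b) * (x \<bullet> c) * U2 (x \<bullet> x)"])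
           (auto simp: partial_derivs_def d2 intro!: continuous_intros rad c1 c2)
    qed
  qed
  then show ?thesis
    using radial_C_on[OF assms] rad[OF c0] by (simp add: C_closure_def)
qed

section \<open>Comparison for the clamped radial plate\<close>

text \<open>A radial profile \<open>\<phi>\<close> in dimension n + 1 with clamped end, together with the flux P of \<open>\<phi>\<close>, the
  profile w of its Laplacian and the flux Q of w; f is the right-hand side of the equation
  B Laplacian w - T w = f. The fluxes stand for the derivatives because they extend
  continuously by 0 to the centre in every dimension.\<close>
locale plate_system =
  fixes n :: nat and B T :: real and f \<phi> P w Q :: "real \<Rightarrow> real"
  assumes cont: "continuous_on {0..1} \<phi>" "continuous_on {0..1} P"
      "continuous_on {0..<1} w" "continuous_on {0..<1} Q"
    and ends: "\<phi> 1 = 0" "P 0 = 0" "P 1 = 0" "Q 0 = 0"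
    and deriv: "\<And>r. r \<in> {0<..<1} \<Longrightarrow> (\<phi> has_real_derivative P r / r ^ n) (at r)"
      "\<And>r. r \<in> {0<..<1} \<Longrightarrow> (P has_real_derivative r ^ n * w r) (at r)"
      "\<And>r. r \<in> {0<..<1} \<Longrightarrow> (w has_real_derivative Q r / r ^ n) (at r)"
      "\<And>r. r \<in> {0<..<1} \<Longrightarrow> (Q has_real_derivative r ^ n * ((T * w r + f r) / B)) (at r)"

definition plate :: "nat \<Rightarrow> real \<Rightarrow> real \<Rightarrow> (real \<Rightarrow> real) \<Rightarrow> (real \<Rightarrow> real) \<Rightarrow> bool" where
  "plate n B T f \<phi> \<longleftrightarrow> (\<exists>P w Q. plate_system n B T f \<phi> P w Q)"

lemma plate_diff:
  assumes "plate n B T f \<phi>" "plate n B T g \<psi>"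
  shows "plate n B T (\<lambda>r. f r - g r) (\<lambda>r. \<phi> r - \<psi> r)"
proof -
  from assms obtain P w Q P' w' Q' where
    "plate_system n B T f \<phi> P w Q" "plate_system n B T g \<psi> P' w' Q'"
    unfolding plate_def by blast
  then interpret F: plate_system n B T f \<phi> P w Q + G: plate_system n B T g \<psi> P' w' Q'
    by simp_all
  have "plate_system n B T (\<lambda>r. f r - g r) (\<lambda>r. \<phi> r - \<psi> r)
     (\<lambda>r. P r - P' r) (\<lambda>r. w r - w' r) (\<lambda>r. Q r - Q' r)"
  proof
    fix r :: real assume r: "r \<in> {0<..<1}"
    show "((\<lambda>r. \<phi> r - \<psi> r) has_real_derivative (P r - P' r) / r ^ n) (at r)"
      using DERIV_diff[OF F.deriv(1)[OF r] G.deriv(1)[OF r]] by (simp add: diff_divide_distrib)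
    show "((\<lambda>r. P r - P' r) has_real_derivative r ^ n * (w r - w' r)) (at r)"
      using DERIV_diff[OF F.deriv(2)[OF r] G.deriv(2)[OF r]] by (simp add: right_diff_distrib)
    show "((\<lambda>r. w r - w' r) has_real_derivative (Q r - Q' r) / r ^ n) (at r)"
      using DERIV_diff[OF F.deriv(3)[OF r] G.deriv(3)[OF r]] by (simp add: diff_divide_distrib)
    have "r ^ n * ((T * w r + f r) / B) - r ^ n * ((T * w' r + g r) / B)
        = r ^ n * ((T * (w r - w' r) + (f r - g r)) / B)"
      by (simp add: diff_divide_distrib add_divide_distrib algebra_simps)
    then show "((\<lambda>r. Q r - Q' r) has_real_derivative r ^ n * ((T * (w r - w' r) + (f r - g r)) / B)) (at r)"
      using DERIV_diff[OF F.deriv(4)[OF r] G.deriv(4)[OF r]] by simp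
  qed (auto intro!: continuous_on_diff F.cont G.cont simp: F.ends G.ends)
  then show ?thesis unfolding plate_def by blast
qed

lemma plate_scale:
  assumes "plate n B T f \<phi>"
  shows "plate n B T (\<lambda>r. c * f r) (\<lambda>r. c * \<phi> r)"
proof -
  from assms obtain P w Q where "plate_system n B T f \<phi> P w Q"
    unfolding plate_def by blast
  then interpret plate_system n B T f \<phi> P w Q .
  have "plate_system n B T (\<lambda>r. c * f r) (\<lambda>r. c * \<phi> r) (\<lambda>r. c * P r) (\<lambda>r. c * w r) (\<lambda>r. c * Q r)"
  proof
    fix r :: real assume r: "r \<in> {0<..<1}"
    show "((\<lambda>r. c * \<phi> r) has_real_derivative c * P r / r ^ n) (at r)"
      using DERIV_cmult[OF deriv(1)[OF r], of c] by simp
    show "((\<lambda>r. c * P r) has_real_derivative r ^ n * (c * w r)) (at r)"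
      using DERIV_cmult[OF deriv(2)[OF r], of c] by (simp add: mult.left_commute)
    show "((\<lambda>r. c * w r) has_real_derivative c * Q r / r ^ n) (at r)"
      using DERIV_cmult[OF deriv(3)[OF r], of c] by simp
    have "c * (r ^ n * ((T * w r + f r) / B)) = r ^ n * ((T * (c * w r) + c * f r) / B)"
      by (simp add: divide_inverse algebra_simps)
    then show "((\<lambda>r. c * Q r) has_real_derivative r ^ n * ((T * (c * w r) + c * f r) / B)) (at r)"
      using DERIV_cmult[OF deriv(4)[OF r], of c] by (simp only:)
  qed (auto intro!: continuous_on_mult_left cont simp: ends)
  then show ?thesis unfolding plate_def by blast
qed

text \<open>If w were negative somewhere and positive later, it would have a negative minimum before the
  later point, either inside or at the centre. In both cases the flux Q vanishes there, and Q' < 0 near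
  the minimum because T w + f < 0, so w would decrease strictly beyond its minimum.\<close>
lemma no_negative_to_positive:
  fixes w Q :: "real \<Rightarrow> real"
  assumes B: "0 < B" and T: "0 < T"
    and cw: "continuous_on {0..<1} w" and cQ: "continuous_on {0..<1} Q" and Q0: "Q 0 = 0"
    and w': "\<And>r. r \<in> {0<..<1} \<Longrightarrow> (w has_real_derivative Q r / r ^ n) (at r)"
    and Q': "\<And>r. r \<in> {0<..<1} \<Longrightarrow> (Q has_real_derivative r ^ n * ((T * w r + f r) / B)) (at r)"
    and f: "\<And>r. r \<in> {0<..<1} \<Longrightarrow> f r \<le> 0"
    and ab: "0 < a" "a < b" "b < 1" "w a < 0" "0 < w b"
  shows False
proof -
  have cwb: "continuous_on {0..b} w"
    by (rule continuous_on_subset[OF cw]) (use ab in auto)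
  have "{0..b} \<noteq> {}" using ab by simp
  from continuous_attains_inf[OF compact_Icc this cwb]
  obtain m where m: "m \<in> {0..b}" and min: "\<And>r. r \<in> {0..b} \<Longrightarrow> w m \<le> w r" by blast
  have wm: "w m < 0" using min[of a] ab by auto
  with ab have mb: "m < b" using m by (cases "m = b") auto
  \<comment> \<open>At the centre the flux vanishes anyway; at an interior minimum the derivative of w does.\<close>
  have Qm: "Q m = 0"
  proof (cases "m = 0")
    case False
    with m mb ab have m01: "m \<in> {0<..<1}" by auto
    have "Q m / m ^ n = 0"
    proof (rule DERIV_local_min[OF w'[OF m01], of "min m (b - m)"])
      show "\<forall>y. \<bar>m - y\<bar> < min m (b - m) \<longrightarrow> w m \<le> w y"
        by (intro allI impI min) (auto simp: min_def abs_if split: if_splits)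
    qed (use m01 mb in auto)
    with m01 show ?thesis by auto
  qed (use Q0 in simp)
  obtain d where d: "d > 0" and wd: "\<forall>r\<in>{0..b}. dist r m < d \<longrightarrow> dist (w r) (w m) < - w m"
    using cwb[unfolded continuous_on_iff, rule_format, OF m, of "- w m"] wm by auto
  define c where "c = min b (m + d / 2)"
  have c: "m < c" "c \<le> b" using mb d by (auto simp: c_def)
  have neg: "w r < 0" if "r \<in> {m..c}" for r
  proof -
    have "r \<in> {0..b}" "dist r m < d" using that m c d by (auto simp: c_def dist_real_def)
    with wd have "dist (w r) (w m) < - w m" by blast
    then show ?thesis by (simp add: dist_real_def abs_less_iff)
  qed
  have Qneg: "Q r < 0" if r: "r \<in> {m<..c}" for r
  proof -
    have "Q r < Q m"
    proof (rule DERIV_neg_imp_decreasing_open[of m r])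
      show "\<exists>y. (Q has_real_derivative y) (at x) \<and> y < 0" if "m < x" "x < r" for x
      proof -
        have x: "x \<in> {0<..<1}" "x \<in> {m..c}" using that r m c ab by auto
        have "T * w x < 0" using neg[OF x(2)] T by (simp add: mult_pos_neg)
        then have "x ^ n * ((T * w x + f x) / B) < 0"
          using f[OF x(1)] x(1) B by (intro mult_pos_neg divide_neg_pos) auto
        with Q'[OF x(1)] show ?thesis by blast
      qed
      show "continuous_on {m..r} Q"
        by (rule continuous_on_subset[OF cQ]) (use r m c ab in auto)
    qed (use r in auto)
    with Qm show ?thesis by simp
  qed
  have "w c < w m"
  proof (rule DERIV_neg_imp_decreasing_open[of m c])
    show "\<exists>y. (w has_real_derivative y) (at x) \<and> y < 0" if "m < x" "x < c" for x
    proof -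
      have x: "x \<in> {0<..<1}" "x \<in> {m<..c}" using that m c ab by auto
      have "Q x / x ^ n < 0" using Qneg[OF x(2)] x(1) by (intro divide_neg_pos) auto
      with w'[OF x(1)] show ?thesis by blast
    qed
    show "continuous_on {m..c} w"
      by (rule continuous_on_subset[OF cw]) (use m c ab in auto)
  qed (use c in auto)
  with min[of c] m c show False by auto
qed

text \<open>P starts and ends at 0. If it were negative at s, the mean value theorem would give a point before s
  where w is negative and a point after s where w is positive.\<close>
lemma plate_nondecreasing:
  assumes "0 < B" "0 < T"
    and "plate n B T f \<phi>" "\<And>r. r \<in> {0<..<1} \<Longrightarrow> f r \<le> 0"
    and xy: "x \<in> {0..1}" "y \<in> {0..1}" "x \<le> y"
  shows "\<phi> x \<le> \<phi> y"
proof -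
  from assms(3) obtain P w Q where "plate_system n B T f \<phi> P w Q"
    unfolding plate_def by blast
  then interpret plate_system n B T f \<phi> P w Q .
  note D = deriv
  have P: "0 \<le> P s" if s: "s \<in> {0<..<1}" for s
  proof (rule ccontr)
    assume neg: "\<not> 0 \<le> P s"
    have cP: "continuous_on {0..s} P" "continuous_on {s..1} P"
      using continuous_on_subset[OF cont(2)] s by auto
    have dP: "P differentiable at x" if "0 < x" "x < 1" for x
      using D(2)[of x] that unfolding real_differentiable_def by auto
    obtain l z where z: "0 < z" "z < s" "(P has_real_derivative l) (at z)" "P s - P 0 = (s - 0) * l"
      using MVT[of 0 s P] s cP(1) dP by auto
    obtain k y where y: "s < y" "y < 1" "(P has_real_derivative k) (at y)" "P 1 - P s = (1 - s) * k"
      using MVT[of s 1 P] s cP(2) dP by auto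
    have zy: "z \<in> {0<..<1}" "y \<in> {0<..<1}" using z y s by auto
    have "l = z ^ n * w z" "k = y ^ n * w y"
      by (rule DERIV_unique[OF z(3) D(2)[OF zy(1)]], rule DERIV_unique[OF y(3) D(2)[OF zy(2)]])
    moreover have "s * l < 0" "0 < (1 - s) * k" using neg z(4) y(4) ends by auto
    then have "l < 0" "0 < k" using s by (auto simp: mult_less_0_iff zero_less_mult_iff)
    ultimately have "w z < 0" "0 < w y"
      using zy by (auto simp: mult_less_0_iff zero_less_mult_iff)
    then show False
      by (intro no_negative_to_positive[OF assms(1,2) cont(3,4) ends(4) D(3,4) assms(4), of z y])
         (use z y s in auto)
  qed
  show ?thesis
  proof (cases "x = y")
    case False
    show ?thesis
    proof (rule DERIV_nonneg_imp_increasing_open[of x y])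
      show "\<exists>d. (\<phi> has_real_derivative d) (at r) \<and> 0 \<le> d" if "x < r" "r < y" for r
      proof -
        have r: "r \<in> {0<..<1}" using that xy by auto
        have "0 \<le> P r / r ^ n" using P[OF r] r by simp
        with D(1)[OF r] show ?thesis by blast
      qed
      show "continuous_on {x..y} \<phi>" using continuous_on_subset[OF cont(1)] xy by auto
    qed (use xy in auto)
  qed simp
qed

lemma plate_end: "plate n B T f \<phi> \<Longrightarrow> \<phi> 1 = 0"
  unfolding plate_def plate_system_def by blast

lemma plate_continuous: "plate n B T f \<phi> \<Longrightarrow> continuous_on {0..1} \<phi>"
  unfolding plate_def plate_system_def by blast

lemma plate_nonpos:
  assumes "0 < B" "0 < T"
    and "plate n B T f \<phi>" "\<And>r. r \<in> {0<..<1} \<Longrightarrow> f r \<le> 0" and "r \<in> {0..1}"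
  shows "\<phi> r \<le> 0"
  using plate_nondecreasing[OF assms(1-4), of r 1] plate_end[OF assms(3)] assms(5) by auto

lemma plate_le:
  assumes "0 < B" "0 < T" "plate n B T f \<phi>" "plate n B T g \<psi>"
    and "\<And>r. r \<in> {0<..<1} \<Longrightarrow> f r \<le> g r" and "r \<in> {0..1}"
  shows "\<phi> r \<le> \<psi> r"
proof -
  have "\<phi> r - \<psi> r \<le> 0"
    by (rule plate_nonpos[OF assms(1,2) plate_diff[OF assms(3,4)]]) (use assms(5,6) in auto)
  then show ?thesis by simp
qed

text \<open>If \<open>\<phi>\<close> reached 0 before the end, monotonicity would make it vanish from there on; then P, w and Q
  vanish as well and the equation leaves f = 0.\<close>
lemma plate_neg:
  assumes BT: "0 < B" "0 < T"
    and p: "plate n B T f \<phi>" and f: "\<And>r. r \<in> {0<..<1} \<Longrightarrow> f r < 0" and r: "r \<in> {0..<1}"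
  shows "\<phi> r < 0"
proof (rule ccontr)
  assume "\<not> \<phi> r < 0"
  have f0: "\<And>r. r \<in> {0<..<1} \<Longrightarrow> f r \<le> 0" using f less_imp_le by blast
  have z: "\<phi> s = 0" if "s \<in> {r..1}" for s
  proof -
    have "\<phi> s \<le> 0" by (rule plate_nonpos[OF BT p f0]) (use that r in auto)
    moreover have "\<phi> r \<le> \<phi> s" by (rule plate_nondecreasing[OF BT p f0]) (use that r in auto)
    ultimately show ?thesis using \<open>\<not> \<phi> r < 0\<close> by simp
  qed
  from p obtain P w Q where "plate_system n B T f \<phi> P w Q"
    unfolding plate_def by blast
  then interpret plate_system n B T f \<phi> P w Q .
  note D = deriv
  have zero: "d = 0" if "(h has_real_derivative d) (at s)" "s \<in> {r<..<1}"
      "\<And>s. s \<in> {r<..<1} \<Longrightarrow> h s = 0" for h d s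
  proof -
    have "((\<lambda>_. 0) has_real_derivative d) (at s)"
      by (rule has_field_derivative_transform_within_open[OF that(1), of "{r<..<1}"]) (use that in auto)
    then show ?thesis using DERIV_unique[OF _ DERIV_const] by blast
  qed
  have "P s = 0" if "s \<in> {r<..<1}" for s
    using zero[OF D(1), of s] z that r by force
  then have "w s = 0" if "s \<in> {r<..<1}" for s
    using zero[OF D(2), of s] that r by force
  then have wQ: "w s = 0 \<and> Q s = 0" if "s \<in> {r<..<1}" for s
    using zero[OF D(3), of s] that r by force
  define s where "s = (r + 1) / 2"
  have s: "s \<in> {r<..<1}" "s \<in> {0<..<1}" using r by (auto simp: s_def)
  then have "s ^ n * ((T * w s + f s) / B) = 0"
    using zero[OF D(4), of s] wQ by blast
  then show False using s f[OF s(2)] wQ[OF s(1)] BT by auto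
qed

section \<open>Radial classical functions satisfy the plate system\<close>

lemma line_derivative:
  assumes "v differentiable (at (r *\<^sub>R e))"
  shows "((\<lambda>r. v (r *\<^sub>R e)) has_real_derivative partial_deriv e v (r *\<^sub>R e)) (at r)"
proof -
  have v: "(v has_derivative frechet_derivative v (at (r *\<^sub>R e))) (at (r *\<^sub>R e))"
    using assms by (simp add: frechet_derivative_works)
  have "((\<lambda>r. r *\<^sub>R e) has_derivative (\<lambda>h. h *\<^sub>R e)) (at r)"
    by (auto intro!: derivative_eq_intros)
  from has_derivative_compose[OF this v]
  have "((\<lambda>r. v (r *\<^sub>R e)) has_derivative (\<lambda>h. frechet_derivative v (at (r *\<^sub>R e)) (h *\<^sub>R e))) (at r)" .
  moreover have "(\<lambda>h. frechet_derivative v (at (r *\<^sub>R e)) (h *\<^sub>R e)) = (*) (partial_deriv e v (r *\<^sub>R e))"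
    using linear_scale[OF has_derivative_linear[OF v]]
    by (auto simp: fun_eq_iff partial_deriv_def mult.commute)
  ultimately show ?thesis by (simp add: has_field_derivative_def)
qed

text \<open>Here p is the radial derivative along the axis spanned by e. At the origin it vanishes because a
  radial function is even on that axis; in dimension one this is the only reason why the flux
  vanishes there.\<close>
lemma
  fixes v :: "'a::euclidean_space \<Rightarrow> real" and e :: 'a
  defines "p \<equiv> \<lambda>r. partial_deriv e v (r *\<^sub>R e)" and "q \<equiv> \<lambda>r. partial_deriv e (partial_deriv e v) (r *\<^sub>R e)"
  assumes e: "e \<in> Basis" and v: "C_on 2 (ball 0 1) v"
    and rad: "\<And>x y. x \<in> ball 0 1 \<Longrightarrow> y \<in> ball 0 1 \<Longrightarrow> norm x = norm y \<Longrightarrow> v x = v y"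
  shows radial_line_derivative: "\<And>r. \<bar>r\<bar> < 1 \<Longrightarrow> ((\<lambda>r. v (r *\<^sub>R e)) has_real_derivative p r) (at r)"
    and radial_line_derivative_continuous: "continuous_on {0..<1} p"
    and radial_line_derivative_origin: "p 0 = 0"
    and laplacian_radial: "\<And>x. x \<in> ball 0 1 - {0} \<Longrightarrow>
      laplacian v x = q (norm x) + real (DIM('a) - 1) * (p (norm x) / norm x)"
    and radial_flux_derivative: "\<And>r. r \<in> {0<..<1} \<Longrightarrow>
      ((\<lambda>r. r ^ (DIM('a) - 1) * p r) has_real_derivative r ^ (DIM('a) - 1) * laplacian v (r *\<^sub>R e)) (at r)"
proof -
  have dv: "v differentiable (at x)" if "x \<in> ball 0 1" for x
    using v that by (simp add: numeral_2_eq_2 C_on_Suc)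
  have dbv: "partial_deriv b v differentiable (at x)" if "x \<in> ball 0 1" "b \<in> Basis" for x b
    using v that by (simp add: numeral_2_eq_2 C_on_Suc)
  have norm_e: "norm e = 1" using e by simp
  then have in_ball: "r *\<^sub>R e \<in> ball 0 1 \<longleftrightarrow> \<bar>r\<bar> < 1" for r by simp
  show line: "((\<lambda>r. v (r *\<^sub>R e)) has_real_derivative p r) (at r)" if "\<bar>r\<bar> < 1" for r
    unfolding p_def using line_derivative[OF dv] in_ball that by blast
  have p': "(p has_real_derivative q r) (at r)" if "\<bar>r\<bar> < 1" for r
    unfolding p_def q_def using line_derivative[OF dbv[OF _ e]] in_ball that by blast
  show "continuous_on {0..<1} p"
    by (intro continuous_at_imp_continuous_on ballI DERIV_isCont[OF p']) auto
  show "p 0 = 0"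
  proof -
    have "((\<lambda>r. v ((- r) *\<^sub>R e)) has_real_derivative - p 0) (at 0)"
      using DERIV_mirror[where f = "\<lambda>r. v (r *\<^sub>R e)" and x = 0 and y = "p 0"] line[of 0] by simp
    then have "((\<lambda>r. v (r *\<^sub>R e)) has_real_derivative - p 0) (at 0)"
    proof (rule has_field_derivative_transform_within_open[of _ _ _ "{-1<..<1}"])
      show "v ((- r) *\<^sub>R e) = v (r *\<^sub>R e)" if "r \<in> {-1<..<1}" for r
        using that norm_e by (intro rad) auto
    qed auto
    then have "- p 0 = p 0" using DERIV_unique line[of 0] by fastforce
    then show ?thesis by simp
  qed
  have op: "open (ball 0 1 - {0::'a})" by (simp add: open_delete)
  have radial_part: "((\<lambda>y. f (norm y)) has_derivative (\<lambda>h. d * (h \<bullet> sgn y))) (at y)"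
    if "y \<noteq> 0" "(f has_real_derivative d) (at (norm y))" for f d and y :: 'a
    using has_derivative_compose[OF has_derivative_norm[OF that(1)] that(2)[unfolded has_field_derivative_def]] .
  have p1: "partial_deriv b v y = p (norm y) * ((y \<bullet> b) / norm y)" if y: "y \<in> ball 0 1 - {0}" for b y
  proof -
    have "((\<lambda>y. v (norm y *\<^sub>R e)) has_derivative (\<lambda>h. p (norm y) * (h \<bullet> sgn y))) (at y)"
      by (rule radial_part[OF _ line]) (use y in auto)
    then have "(v has_derivative (\<lambda>h. p (norm y) * (h \<bullet> sgn y))) (at y)"
    proof (rule has_derivative_transform_within_open[OF _ op y])
      show "v (norm z *\<^sub>R e) = v z" if "z \<in> ball 0 1 - {0}" for z
        using that norm_e by (intro rad) auto
    qed
    from partial_deriv_eq[OF this, of b] show ?thesis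
      by (simp add: sgn_div_norm inner_commute divide_inverse)
  qed
  show lap: "laplacian v x = q (norm x) + real (DIM('a) - 1) * (p (norm x) / norm x)"
    if x: "x \<in> ball 0 1 - {0}" for x
  proof -
    have x0: "norm x > 0" "x \<noteq> 0" and x1: "\<bar>norm x\<bar> < 1" using x by auto
    have p2: "partial_deriv b (partial_deriv b v) x = p (norm x) / norm x
        + (q (norm x) - p (norm x) / norm x) * ((x \<bullet> b) * (x \<bullet> b)) / (norm x)\<^sup>2" if b: "b \<in> Basis" for b
    proof -
      have "((\<lambda>y. (y \<bullet> b) / norm y) has_derivative
          (\<lambda>h. ((h \<bullet> b) * norm x - (x \<bullet> b) * (h \<bullet> sgn x)) / (norm x * norm x))) (at x)"
        using x0 by (intro has_derivative_divide' has_derivative_norm) (auto intro!: derivative_eq_intros)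
      from has_derivative_mult[OF radial_part[OF x0(2) p'[OF x1]] this]
      have "partial_deriv b (\<lambda>y. p (norm y) * ((y \<bullet> b) / norm y)) x =
          p (norm x) * (((b \<bullet> b) * norm x - (x \<bullet> b) * (b \<bullet> sgn x)) / (norm x * norm x))
          + q (norm x) * (b \<bullet> sgn x) * ((x \<bullet> b) / norm x)"
        by (rule partial_deriv_eq)
      moreover have "b \<bullet> sgn x = (x \<bullet> b) / norm x"
        by (simp add: sgn_div_norm inner_commute divide_inverse)
      moreover have "partial_deriv b (partial_deriv b v) x
          = partial_deriv b (\<lambda>y. p (norm y) * ((y \<bullet> b) / norm y)) x"
        by (rule partial_deriv_cong[OF op x p1])
      ultimately have "partial_deriv b (partial_deriv b v) x =
          p (norm x) * ((norm x - (x \<bullet> b) * ((x \<bullet> b) / norm x)) / (norm x * norm x))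
          + q (norm x) * ((x \<bullet> b) / norm x) * ((x \<bullet> b) / norm x)"
        using b by simp
      then show ?thesis using x0(1) by (simp add: field_simps power2_eq_square)
    qed
    have "laplacian v x = (\<Sum>b\<in>Basis. p (norm x) / norm x
        + (q (norm x) - p (norm x) / norm x) / (norm x)\<^sup>2 * ((x \<bullet> b) * (x \<bullet> b)))"
      unfolding laplacian_def by (rule sum.cong) (simp_all add: p2)
    also have "\<dots> = real DIM('a) * (p (norm x) / norm x) + (q (norm x) - p (norm x) / norm x)"
    proof -
      have "(\<Sum>b\<in>Basis. (x \<bullet> b) * (x \<bullet> b)) = (norm x)\<^sup>2"
        by (simp add: dot_square_norm flip: euclidean_inner)
      then show ?thesis
        unfolding sum.distrib sum_distrib_left[symmetric] using x0 by simp
    qed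
    also have "real DIM('a) = real (DIM('a) - 1) + 1"
      using DIM_positive[where 'a='a] by linarith
    finally show ?thesis unfolding distrib_right mult_1 by linarith
  qed
  fix r :: real assume r: "r \<in> {0<..<1}"
  have "((\<lambda>r. r ^ n * p r) has_real_derivative r ^ n * (q r + real n * (p r / r))) (at r)" for n
  proof -
    have "real n * r ^ (n - Suc 0) = r ^ n * (real n / r)" using r by (cases n) auto
    then show ?thesis
      using DERIV_mult[OF DERIV_pow[of n r] p'[of r]] r by (simp add: algebra_simps)
  qed
  moreover have "laplacian v (r *\<^sub>R e) = q r + real (DIM('a) - 1) * (p r / r)"
  proof -
    have "e \<noteq> 0" using norm_e by auto
    then show ?thesis using lap[of "r *\<^sub>R e"] r norm_e by auto
  qed
  ultimately show "((\<lambda>r. r ^ (DIM('a) - 1) * p r) has_real_derivative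
        r ^ (DIM('a) - 1) * laplacian v (r *\<^sub>R e)) (at r)" by (simp only:)
qed

text \<open>The boundary condition prescribes a one-sided derivative at the sphere, while regularity up to the
  boundary gives a limit of derivatives. By the fundamental theorem of calculus the two agree.\<close>
lemma endpoint_derivative:
  fixes \<phi> H :: "real \<Rightarrow> real"
  assumes \<phi>: "continuous_on {0..1} \<phi>" and H: "continuous_on {0..1} H"
    and D: "\<And>r. r \<in> {0<..<1} \<Longrightarrow> (\<phi> has_real_derivative H r) (at r)"
    and D1: "(\<phi> has_real_derivative d) (at 1 within {0..1})"
  shows "H 1 = d"
proof -
  have I: "\<phi> x = \<phi> 0 + integral {0..x} H" if x: "x \<in> {0..1}" for x
  proof -
    have "continuous_on {0..x} \<phi>" by (rule continuous_on_subset[OF \<phi>]) (use x in auto)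
    moreover have "(\<phi> has_vector_derivative H r) (at r)" if "r \<in> {0<..<x}" for r
      using D[of r] that x by (simp flip: has_real_derivative_iff_has_vector_derivative)
    ultimately have "(H has_integral \<phi> x - \<phi> 0) {0..x}"
      using fundamental_theorem_of_calculus_interior[of 0 x \<phi> H] x by simp
    then show ?thesis by (simp add: integral_unique)
  qed
  have "((\<lambda>x. \<phi> 0 + integral {0..x} H) has_real_derivative H 1) (at 1 within {0..1})"
    using DERIV_add[OF DERIV_const integral_has_real_derivative[OF H, of 1]] by simp
  then have "(\<phi> has_real_derivative H 1) (at 1 within {0..1})"
    unfolding has_field_derivative_def
    by (rule has_derivative_transform[rotated 2]) (simp, rule I)
  with D1 show ?thesis
    unfolding has_real_derivative_iff_has_vector_derivative
    using vector_derivative_unique_within_closed_interval[of 0 1 1 \<phi> "H 1" d] by simp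
qed

lemma classical_plate:
  fixes s :: "'a::euclidean_space \<Rightarrow> real"
  assumes e: "e \<in> Basis" and B: "0 < B"
    and rad: "radially_symmetric s" and s4: "C_on 4 (ball 0 1) s"
    and s2: "C_closure 2 (ball 0 1) s" and cl: "clamped s"
  shows "plate (DIM('a) - 1) B T
    (\<lambda>r. B * bilaplacian s (r *\<^sub>R e) - T * laplacian s (r *\<^sub>R e)) (\<lambda>r. s (r *\<^sub>R e))"
proof -
  let ?w = "laplacian s" and ?n = "DIM('a) - 1"
  have norm_e: "norm e = 1" using e by simp
  have C2: "C_on 2 (ball 0 1) s" "C_on 2 (ball 0 1) ?w"
    using C_on_laplacian[of "ball 0 1" 2 s] C_on_SucD[of 3 "ball 0 1" s] C_on_SucD[of 2 "ball 0 1" s] s4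
    by (simp_all add: numeral_eq_Suc)
  have rs: "s x = s y" if "x \<in> ball 0 1" "y \<in> ball 0 1" "norm x = norm y" for x y
    using rad that by (auto simp: radially_symmetric_def)
  note S = e C2(1) rs
  have rw: "?w x = ?w y" if xy: "x \<in> ball 0 1" "y \<in> ball 0 1" "norm x = norm y" for x y
    using laplacian_radial[OF S, of x] laplacian_radial[OF S, of y] xy by (cases "x = 0"; cases "y = 0") auto
  note W = e C2(2) rw
  obtain h where h: "continuous_on (cball 0 1) h" "\<And>x. x \<in> ball 0 1 \<Longrightarrow> h x = partial_deriv e s x"
    using s2 e unfolding C_closure_def by (auto simp: partial_derivs_def dest!: spec[of _ "[e]"])
  have cs: "continuous_on (cball 0 1) s" using s2 by (simp add: C_closure_def)
  have line: "continuous_on {0..1} (\<lambda>r. k (r *\<^sub>R e))" if "continuous_on (cball 0 1) k" for k :: "'a \<Rightarrow> real"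
    by (rule continuous_on_compose2[OF that]) (auto intro!: continuous_intros simp: norm_e)
  \<comment> \<open>The one-sided normal derivative at e, shifted from 0 to 1 along the axis.\<close>
  have h1: "h e = 0"
  proof -
    have "((\<lambda>t. s (e + t *\<^sub>R e)) has_real_derivative 0) (at 0 within {..0})"
      using cl norm_e by (simp add: clamped_def has_normal_derivative_def)
    then have "((\<lambda>t. s (e + t *\<^sub>R e)) has_real_derivative 0) (at 0 within (\<lambda>r. r - 1) ` {0..1})"
      by (rule DERIV_subset) auto
    then have "((\<lambda>t. s (e + t *\<^sub>R e)) has_real_derivative 0) (at (1 - 1) within (\<lambda>r. r - 1) ` {0..1})"
      by simp
    then have "((\<lambda>t. s (e + t *\<^sub>R e)) \<circ> (\<lambda>r. r - 1) has_real_derivative 0 * 1) (at 1 within {0..1})"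
      by (rule DERIV_image_chain) (auto intro!: derivative_eq_intros)
    then have "((\<lambda>r. s (r *\<^sub>R e)) has_real_derivative 0) (at 1 within {0..1})"
      by (simp add: o_def algebra_simps)
    moreover have "((\<lambda>r. s (r *\<^sub>R e)) has_real_derivative h (r *\<^sub>R e)) (at r)" if "r \<in> {0<..<1}" for r
      using radial_line_derivative[OF S, of r] h(2)[of "r *\<^sub>R e"] that norm_e by simp
    ultimately show ?thesis
      using endpoint_derivative[OF line[OF cs] line[OF h(1)]] by simp
  qed
  show ?thesis
    unfolding plate_def
  proof (intro exI plate_system.intro)
    fix r :: real assume r: "r \<in> {0<..<1}"
    then have hr: "h (r *\<^sub>R e) = partial_deriv e s (r *\<^sub>R e)" using h(2) norm_e by simp
    show "((\<lambda>r. s (r *\<^sub>R e)) has_real_derivative (r ^ ?n * h (r *\<^sub>R e)) / r ^ ?n) (at r)"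
      using radial_line_derivative[OF S, of r] r hr by simp
    show "((\<lambda>r. r ^ ?n * h (r *\<^sub>R e)) has_real_derivative r ^ ?n * ?w (r *\<^sub>R e)) (at r)"
      by (rule has_field_derivative_transform_within_open[OF radial_flux_derivative[OF S r], of "{0<..<1}"])
         (use r h(2) norm_e in auto)
    show "((\<lambda>r. ?w (r *\<^sub>R e)) has_real_derivative (r ^ ?n * partial_deriv e ?w (r *\<^sub>R e)) / r ^ ?n) (at r)"
      using radial_line_derivative[OF W, of r] r by simp
    show "((\<lambda>r. r ^ ?n * partial_deriv e ?w (r *\<^sub>R e)) has_real_derivative
        r ^ ?n * ((T * ?w (r *\<^sub>R e) + (B * bilaplacian s (r *\<^sub>R e) - T * ?w (r *\<^sub>R e))) / B)) (at r)"
      using radial_flux_derivative[OF W r] B by (simp add: bilaplacian_def)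
  next
    show "continuous_on {0..<1} (\<lambda>r. ?w (r *\<^sub>R e))"
      by (rule continuous_on_compose2[OF C_on_imp_continuous[OF C2(2)]])
         (auto intro!: continuous_intros simp: norm_e)
    show "continuous_on {0..<1} (\<lambda>r. r ^ ?n * partial_deriv e ?w (r *\<^sub>R e))"
      by (intro continuous_intros radial_line_derivative_continuous[OF W])
  qed (use cl h1 radial_line_derivative_origin[OF S] radial_line_derivative_origin[OF W] h(2)[of 0]
       in \<open>auto intro!: continuous_intros line cs h(1) simp: clamped_def norm_e\<close>)
qed

section \<open>Weighted averages\<close>

text \<open>The substitution s = r \<open>\<rho>\<close> turns the primitive of s^n f(s^2) over [0, r] into r^(n+1) avg n f (r^2); this is
  \<open>avg_flux\<close>. Written as an average, the primitive divided by r^(n+1) is visibly as smooth in t = r^2 as f is.\<close>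
definition avg :: "nat \<Rightarrow> (real \<Rightarrow> real) \<Rightarrow> real \<Rightarrow> real" where
  "avg n f t = integral {0..1} (\<lambda>\<rho>. \<rho> ^ n * f (t * \<rho>\<^sup>2))"

lemma unit_scale: "t \<in> {0..1} \<Longrightarrow> \<rho> \<in> {0..1} \<Longrightarrow> t * \<rho>\<^sup>2 \<in> {0..1::real}"
  by (simp add: mult_le_one power_le_one)

lemma avg_integrand_continuous:
  fixes f :: "real \<Rightarrow> real"
  assumes "continuous_on {0..1} f"
  shows "continuous_on ({0..1} \<times> {0..1}) (\<lambda>(t, \<rho>). \<rho> ^ n * f (t * \<rho>\<^sup>2))"
proof -
  have "continuous_on ({0..1} \<times> {0..1}) (\<lambda>p. f (fst p * (snd p)\<^sup>2))"
  proof (rule continuous_on_compose2[OF assms])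
    show "(\<lambda>p. fst p * (snd p)\<^sup>2) ` ({0..1} \<times> {0..1}) \<subseteq> {0..1::real}"
      using unit_scale by fastforce
  qed (intro continuous_intros)
  then show ?thesis
    unfolding case_prod_beta by (rule continuous_on_mult[rotated]) (auto intro!: continuous_intros)
qed

lemma avg_integrand_continuous_fixed:
  fixes f :: "real \<Rightarrow> real"
  assumes "continuous_on {0..1} f" "t \<in> {0..1}"
  shows "continuous_on {0..1} (\<lambda>\<rho>. \<rho> ^ n * f (t * \<rho>\<^sup>2))"
proof -
  have "continuous_on {0..1} (\<lambda>\<rho>. f (t * \<rho>\<^sup>2))"
  proof (rule continuous_on_compose2[OF assms(1)])
    show "(\<lambda>\<rho>. t * \<rho>\<^sup>2) ` {0..1} \<subseteq> {0..1}"
      using unit_scale[OF assms(2)] by blast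
  qed (intro continuous_intros)
  then show ?thesis
    by (rule continuous_on_mult[rotated]) (auto intro!: continuous_intros)
qed

lemma avg_continuous:
  assumes "continuous_on {0..1} f"
  shows "continuous_on {0..1} (avg n f)"
  using integral_continuous_on_param[of "{0..1}" 0 1 "\<lambda>t \<rho>. \<rho> ^ n * f (t * \<rho>\<^sup>2)"]
    avg_integrand_continuous[OF assms, of n]
  by (simp add: avg_def[abs_def])

lemma avg_has_derivative:
  assumes f': "\<And>t. t \<in> {0..1} \<Longrightarrow> (f has_real_derivative f' t) (at t within {0..1})"
    and c: "continuous_on {0..1} f'" and t: "t \<in> {0..1}"
  shows "(avg n f has_real_derivative avg (n + 2) f' t) (at t within {0..1})"
proof -
  have cf: "continuous_on {0..1} f" using f' DERIV_continuous_on by blast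
  have "((\<lambda>t. integral (cbox 0 1) (\<lambda>\<rho>. \<rho> ^ n * f (t * \<rho>\<^sup>2))) has_real_derivative
      integral (cbox 0 1) (\<lambda>\<rho>. \<rho> ^ (n + 2) * f' (t * \<rho>\<^sup>2))) (at t within {0..1})"
  proof (rule leibniz_rule_field_derivative)
    fix t \<rho> :: real assume t: "t \<in> {0..1}" and "\<rho> \<in> cbox 0 1"
    then have \<rho>: "\<rho> \<in> {0..1}" by simp
    have "(f has_real_derivative f' (t * \<rho>\<^sup>2)) (at (t * \<rho>\<^sup>2) within (\<lambda>t. t * \<rho>\<^sup>2) ` {0..1})"
      by (rule DERIV_subset[OF f'[OF unit_scale[OF t \<rho>]]]) (use unit_scale \<rho> in blast)
    then have "(f \<circ> (\<lambda>t. t * \<rho>\<^sup>2) has_real_derivative f' (t * \<rho>\<^sup>2) * \<rho>\<^sup>2) (at t within {0..1})"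
      by (rule DERIV_image_chain) (auto intro!: derivative_eq_intros)
    from DERIV_cmult[OF this, of "\<rho> ^ n"]
    show "((\<lambda>t. \<rho> ^ n * f (t * \<rho>\<^sup>2)) has_real_derivative \<rho> ^ (n + 2) * f' (t * \<rho>\<^sup>2)) (at t within {0..1})"
      by (simp add: o_def power_add power2_eq_square mult_ac)
  next
    fix t :: real assume "t \<in> {0..1}"
    then show "(\<lambda>\<rho>. \<rho> ^ n * f (t * \<rho>\<^sup>2)) integrable_on cbox 0 1"
      using integrable_continuous_interval[OF avg_integrand_continuous_fixed[OF cf]] by simp
  qed (use avg_integrand_continuous[OF c, of "n + 2"] t in \<open>simp_all del: power_add add_2_eq_Suc'\<close>)
  then show ?thesis by (simp add: avg_def[abs_def])
qed

lemma avg_Ck: "Ck k f \<Longrightarrow> Ck k (avg n f)"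
proof (induction k arbitrary: f n)
  case 0
  then show ?case by (simp add: avg_continuous)
next
  case (Suc k)
  then obtain f' where f': "\<forall>t\<in>{0..1}. (f has_real_derivative f' t) (at t within {0..1})" "Ck k f'"
    by auto
  then have "\<forall>t\<in>{0..1}. (avg n f has_real_derivative avg (n + 2) f' t) (at t within {0..1})"
    using avg_has_derivative Ck_imp_continuous by blast
  then show ?case unfolding Ck.simps using Suc.IH[OF f'(2)] by blast
qed

lemma avg_bound:
  assumes "continuous_on {0..1} f" "\<And>t. t \<in> {0..1} \<Longrightarrow> \<bar>f t\<bar> \<le> K" and t: "t \<in> {0..1}"
  shows "\<bar>avg n f t\<bar> \<le> K"
proof -
  have "norm (integral {0..1} (\<lambda>\<rho>. \<rho> ^ n * f (t * \<rho>\<^sup>2))) \<le> K * (1 - 0)"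
  proof (rule integral_bound[OF _ avg_integrand_continuous_fixed[OF assms(1) t]])
    fix \<rho> :: real assume \<rho>: "\<rho> \<in> {0..1}"
    have "\<bar>\<rho> ^ n\<bar> * \<bar>f (t * \<rho>\<^sup>2)\<bar> \<le> 1 * K"
      using \<rho> assms(2)[OF unit_scale[OF t \<rho>]] by (intro mult_mono) (auto simp: power_le_one)
    then show "norm (\<rho> ^ n * f (t * \<rho>\<^sup>2)) \<le> K" by (simp add: abs_mult)
  qed simp
  then show ?thesis by (simp add: avg_def)
qed

lemma avg_linear:
  assumes "continuous_on {0..1} f" "continuous_on {0..1} g" "t \<in> {0..1}"
  shows "avg n (\<lambda>t. c * f t + g t) t = c * avg n f t + avg n g t"
proof -
  have "(\<lambda>\<rho>. \<rho> ^ n * (c * f (t * \<rho>\<^sup>2) + g (t * \<rho>\<^sup>2)))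
      = (\<lambda>\<rho>. c * (\<rho> ^ n * f (t * \<rho>\<^sup>2)) + \<rho> ^ n * g (t * \<rho>\<^sup>2))"
    by (auto simp: algebra_simps)
  moreover have "(\<lambda>\<rho>. \<rho> ^ n * f (t * \<rho>\<^sup>2)) integrable_on {0..1}"
    "(\<lambda>\<rho>. \<rho> ^ n * g (t * \<rho>\<^sup>2)) integrable_on {0..1}"
    using assms by (auto intro!: integrable_continuous_interval avg_integrand_continuous_fixed)
  ultimately show ?thesis
    unfolding avg_def
    by (simp only: integral_add[OF integrable_on_mult_right] integral_mult_right)
qed

lemma avg_lower_bound:
  assumes "continuous_on {0..1} f" "\<And>t. t \<in> {0..1} \<Longrightarrow> 1 \<le> f t"
  shows "1 / (real n + 1) \<le> avg n f 1"
proof -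
  have "integral {0..1} (\<lambda>\<rho>::real. \<rho> ^ n) \<le> integral {0..1} (\<lambda>\<rho>. \<rho> ^ n * f (1 * \<rho>\<^sup>2))"
  proof (rule integral_le)
    show "\<rho> ^ n \<le> \<rho> ^ n * f (1 * \<rho>\<^sup>2)" if "\<rho> \<in> {0..1}" for \<rho> :: real
      using that mult_left_mono[OF assms(2)[OF unit_scale[of 1 \<rho>]], of "\<rho> ^ n"] by auto
  next
    show "(\<lambda>\<rho>. \<rho> ^ n * f (1 * \<rho>\<^sup>2)) integrable_on {0..1}"
      by (intro integrable_continuous_interval avg_integrand_continuous_fixed assms) simp
  qed (auto intro!: integrable_continuous_interval continuous_intros)
  moreover have "((\<lambda>\<rho>::real. \<rho> ^ n) has_integral 1 ^ Suc n / (real n + 1) - 0 ^ Suc n / (real n + 1)) {0..1}"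
  proof (rule fundamental_theorem_of_calculus)
    fix \<rho> :: real
    have "real (Suc n) * \<rho> ^ (Suc n - Suc 0) / (real n + 1) = \<rho> ^ n"
      using of_nat_Suc[of n] by (simp add: add.commute)
    then have "((\<lambda>\<rho>. \<rho> ^ Suc n / (real n + 1)) has_real_derivative \<rho> ^ n) (at \<rho>)"
      using DERIV_cdivide[OF DERIV_pow[of "Suc n" \<rho>], of "real n + 1"] by (simp only:)
    then show "((\<lambda>\<rho>. \<rho> ^ Suc n / (real n + 1)) has_vector_derivative \<rho> ^ n) (at \<rho> within {0..1})"
      unfolding has_real_derivative_iff_has_vector_derivative[symmetric]
      by (rule has_field_derivative_at_within)
  qed simp
  ultimately show ?thesis by (simp add: avg_def integral_unique)
qed

lemma avg_flux:
  assumes f: "continuous_on {0..1} f" and r: "r \<in> {0<..<1}"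
  shows "((\<lambda>r. r ^ Suc n * avg n f (r\<^sup>2)) has_real_derivative r ^ n * f (r\<^sup>2)) (at r)"
proof -
  let ?k = "\<lambda>s. s ^ n * f (s\<^sup>2)"
  have ck: "continuous_on {0..1} ?k"
    using avg_integrand_continuous_fixed[OF f, of 1 n] by simp
  have eq: "integral {0..r} ?k = r ^ Suc n * avg n f (r\<^sup>2)" if r: "r \<in> {0<..<1}" for r
  proof -
    have "((\<lambda>\<rho>. r *\<^sub>R ?k (r * \<rho>)) has_integral integral {r * 0..r * 1} ?k) {0..1}"
    proof (rule has_integral_substitution[where g = "(*) r" and g' = "\<lambda>_. r" and f = ?k and c = 0 and d = 1])
      show "(*) r ` {0..1} \<subseteq> {0..1}" using r by (auto simp: mult_le_one)
      show "((*) r has_real_derivative r) (at \<rho> within {0..1})" for \<rho>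
        by (auto intro!: derivative_eq_intros)
    qed (use r ck in auto)
    from integral_unique[OF this]
    have "integral {0..1} (\<lambda>\<rho>. r *\<^sub>R ?k (r * \<rho>)) = integral {0..r} ?k"
      by (simp only: mult_zero_right mult_1_right)
    moreover have "(\<lambda>\<rho>. r *\<^sub>R ?k (r * \<rho>)) = (\<lambda>\<rho>. r ^ Suc n * (\<rho> ^ n * f (r\<^sup>2 * \<rho>\<^sup>2)))"
      by (auto simp: power_mult_distrib algebra_simps)
    ultimately have "integral {0..1} (\<lambda>\<rho>. r ^ Suc n * (\<rho> ^ n * f (r\<^sup>2 * \<rho>\<^sup>2))) = integral {0..r} ?k"
      by (simp only:)
    then show ?thesis unfolding integral_mult_right avg_def by simp
  qed
  have "((\<lambda>r. integral {0..r} ?k) has_real_derivative ?k r) (at r within {0..1})"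
    using r by (intro integral_has_real_derivative[OF ck]) auto
  then have "((\<lambda>r. integral {0..r} ?k) has_real_derivative ?k r) (at r)"
    using r by (simp add: at_within_Icc_at)
  then show ?thesis
    by (rule has_field_derivative_transform_within_open[of _ _ _ "{0<..<1}"]) (use r eq in auto)
qed

lemma powser_Ck:
  assumes "\<And>x::real. summable (\<lambda>n. c n * x ^ n)"
  shows "Ck k (\<lambda>t. \<Sum>n. c n * t ^ n)"
  using assms
proof (induction k arbitrary: c)
  case 0
  then show ?case
    by (auto intro!: continuous_at_imp_continuous_on DERIV_isCont termdiffs_strong_converges_everywhere simp: 0)
next
  case (Suc k)
  have "Ck k (\<lambda>t. \<Sum>n. diffs c n * t ^ n)"
    by (rule Suc.IH) (rule termdiff_converges_all[OF Suc.prems])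
  moreover have "((\<lambda>t. \<Sum>n. c n * t ^ n) has_real_derivative (\<Sum>n. diffs c n * t ^ n)) (at t within S)" for t S
    by (rule DERIV_subset[OF termdiffs_strong_converges_everywhere[OF Suc.prems]]) simp
  ultimately show ?case
    by (auto intro!: exI[of _ "\<lambda>t. \<Sum>n. diffs c n * t ^ n"])
qed

section \<open>A positive solution of the homogeneous equation\<close>

text \<open>The regular solution of 4 t h'' + 2 (n + 1) h' = \<open>\<kappa>\<close> h with h(0) = 1, that is, of Laplacian h = \<open>\<kappa>\<close> h for
  the radial function h(|x|^2) in dimension n + 1. Up to normalisation it is a modified Bessel function.
  All coefficients are non-negative, whence h \<open>\<ge>\<close> 1.\<close>
definition bessel_coeff :: "nat \<Rightarrow> real \<Rightarrow> nat \<Rightarrow> real" where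
  "bessel_coeff n \<kappa> k = (\<Prod>j<k. \<kappa> / ((real j + 1) * (4 * real j + 2 * (real n + 1))))"

definition bessel :: "nat \<Rightarrow> real \<Rightarrow> real \<Rightarrow> real" where
  "bessel n \<kappa> t = (\<Sum>k. bessel_coeff n \<kappa> k * t ^ k)"

lemma bessel_coeff_nonneg: "0 \<le> \<kappa> \<Longrightarrow> 0 \<le> bessel_coeff n \<kappa> k"
  unfolding bessel_coeff_def by (intro prod_nonneg ballI divide_nonneg_nonneg mult_nonneg_nonneg) auto

lemma bessel_summable:
  assumes "0 \<le> \<kappa>"
  shows "summable (\<lambda>k. bessel_coeff n \<kappa> k * x ^ k)"
proof (rule summable_comparison_test)
  have bound: "bessel_coeff n \<kappa> k \<le> \<kappa> ^ k / fact k" for k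
  proof (induction k)
    case 0
    then show ?case by (simp add: bessel_coeff_def)
  next
    case (Suc k)
    have "\<kappa> / ((real k + 1) * (4 * real k + 2 * (real n + 1))) \<le> \<kappa> / ((real k + 1) * 1)"
      using assms by (intro divide_left_mono mult_left_mono mult_pos_pos) auto
    then have "bessel_coeff n \<kappa> k * (\<kappa> / ((real k + 1) * (4 * real k + 2 * (real n + 1))))
        \<le> \<kappa> ^ k / fact k * (\<kappa> / ((real k + 1) * 1))"
      using Suc assms by (intro mult_mono) (auto intro!: divide_nonneg_nonneg mult_nonneg_nonneg)
    then show ?case by (simp add: bessel_coeff_def field_simps)
  qed
  show "\<exists>N. \<forall>k\<ge>N. norm (bessel_coeff n \<kappa> k * x ^ k) \<le> inverse (fact k) * (\<kappa> * \<bar>x\<bar>) ^ k"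
  proof (intro exI allI impI)
    fix k
    have "bessel_coeff n \<kappa> k * \<bar>x\<bar> ^ k \<le> \<kappa> ^ k / fact k * \<bar>x\<bar> ^ k"
      by (intro mult_right_mono bound) auto
    then show "norm (bessel_coeff n \<kappa> k * x ^ k) \<le> inverse (fact k) * (\<kappa> * \<bar>x\<bar>) ^ k"
      using bessel_coeff_nonneg[OF assms, of n k]
      by (simp add: abs_mult power_abs power_mult_distrib divide_inverse mult_ac)
  qed
qed (rule summable_exp)

lemma bessel_ge_1:
  assumes "0 \<le> \<kappa>" "0 \<le> t"
  shows "1 \<le> bessel n \<kappa> t"
proof -
  have "(\<Sum>k<1. bessel_coeff n \<kappa> k * t ^ k) \<le> bessel n \<kappa> t"
    unfolding bessel_def using assms bessel_coeff_nonneg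
    by (intro sum_le_suminf bessel_summable) auto
  then show ?thesis by (simp add: bessel_coeff_def)
qed

lemma bessel_ode:
  assumes "0 \<le> \<kappa>"
  obtains h1 h2 where
    "\<And>t. (bessel n \<kappa> has_real_derivative h1 t) (at t)"
    "\<And>t. (h1 has_real_derivative h2 t) (at t)"
    "\<And>t. 4 * t * h2 t + 2 * (real n + 1) * h1 t = \<kappa> * bessel n \<kappa> t"
proof -
  let ?c = "bessel_coeff n \<kappa>"
  have s0: "summable (\<lambda>k. ?c k * x ^ k)" for x by (rule bessel_summable[OF assms])
  have s1: "summable (\<lambda>k. diffs ?c k * x ^ k)" for x by (rule termdiff_converges_all[OF s0])
  have s2: "summable (\<lambda>k. diffs (diffs ?c) k * x ^ k)" for x by (rule termdiff_converges_all[OF s1])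
  define h1 where "h1 t = (\<Sum>k. diffs ?c k * t ^ k)" for t
  define h2 where "h2 t = (\<Sum>k. diffs (diffs ?c) k * t ^ k)" for t
  show thesis
  proof (rule that)
    show "(bessel n \<kappa> has_real_derivative h1 t) (at t)" for t
      unfolding bessel_def[abs_def] h1_def by (rule termdiffs_strong_converges_everywhere[OF s0])
    show "(h1 has_real_derivative h2 t) (at t)" for t
      unfolding h1_def[abs_def] h2_def by (rule termdiffs_strong_converges_everywhere[OF s1])
    show "4 * t * h2 t + 2 * (real n + 1) * h1 t = \<kappa> * bessel n \<kappa> t" for t
    proof -
      have "(\<lambda>k. 4 * t * (diffs (diffs ?c) k * t ^ k)) sums (4 * t * h2 t)"
        unfolding h2_def by (intro sums_mult summable_sums s2)
      then have "(\<lambda>k. 4 * real (Suc k) * diffs ?c (Suc k) * t ^ Suc k) sums (4 * t * h2 t)"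
        by (simp add: diffs_def[of "diffs ?c"] algebra_simps)
      then have "(\<lambda>k. 4 * real k * diffs ?c k * t ^ k) sums (4 * t * h2 t)"
        by (subst (asm) sums_Suc_iff) simp
      moreover have "(\<lambda>k. 2 * (real n + 1) * (diffs ?c k * t ^ k)) sums (2 * (real n + 1) * h1 t)"
        unfolding h1_def by (intro sums_mult summable_sums s1)
      ultimately have "(\<lambda>k. 4 * real k * diffs ?c k * t ^ k + 2 * (real n + 1) * (diffs ?c k * t ^ k))
          sums (4 * t * h2 t + 2 * (real n + 1) * h1 t)"
        by (rule sums_add)
      moreover have "4 * real k * diffs ?c k * t ^ k + 2 * (real n + 1) * (diffs ?c k * t ^ k)
          = \<kappa> * (?c k * t ^ k)" for k
      proof -
        have "(real k + 1) * (4 * real k + 2 * (real n + 1)) > 0" by (intro mult_pos_pos) auto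
        then have "?c (Suc k) * ((real k + 1) * (4 * real k + 2 * (real n + 1))) = ?c k * \<kappa>"
          by (simp add: bessel_coeff_def)
        moreover have "4 * real k * diffs ?c k * t ^ k + 2 * (real n + 1) * (diffs ?c k * t ^ k)
            = ?c (Suc k) * ((real k + 1) * (4 * real k + 2 * (real n + 1))) * t ^ k"
          by (simp add: diffs_def algebra_simps)
        ultimately show ?thesis by simp
      qed
      ultimately have "(\<lambda>k. \<kappa> * (?c k * t ^ k)) sums (4 * t * h2 t + 2 * (real n + 1) * h1 t)"
        by simp
      moreover have "(\<lambda>k. \<kappa> * (?c k * t ^ k)) sums (\<kappa> * bessel n \<kappa> t)"
        unfolding bessel_def by (intro sums_mult summable_sums s0)
      ultimately show ?thesis by (rule sums_unique2)
    qed
  qed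
qed

text \<open>The derivative in r of V(r^2) is 2 r V1(r^2), so the hypothesis is the radial equation in divergence
  form. Inside the interval it is expanded in the variable t; the two ends follow by continuity.\<close>
lemma radial_ode:
  assumes V1: "\<And>t. t \<in> {0..1} \<Longrightarrow> (V1 has_real_derivative V2 t) (at t within {0..1})"
    and c: "continuous_on {0..1} V2" "continuous_on {0..1} g"
    and flux: "\<And>r. r \<in> {0<..<1} \<Longrightarrow>
      ((\<lambda>r. r ^ n * (2 * r * V1 (r\<^sup>2))) has_real_derivative r ^ n * g (r\<^sup>2)) (at r)"
    and t: "t \<in> {0..1}"
  shows "4 * t * V2 t + 2 * (real n + 1) * V1 t = g t"
proof -
  have c1: "continuous_on {0..1} V1" using V1 DERIV_continuous_on by blast
  have "4 * t * V2 t + 2 * (real n + 1) * V1 t - g t = 0"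
  proof (rule continuous_constant_on_closure[of "{0<..<1}" "\<lambda>t. 4 * t * V2 t + 2 * (real n + 1) * V1 t - g t"])
    show "continuous_on (closure {0<..<1}) (\<lambda>t. 4 * t * V2 t + 2 * (real n + 1) * V1 t - g t)"
      using c c1 by (auto intro!: continuous_intros)
    fix t :: real assume t: "t \<in> {0<..<1}"
    define r where "r = sqrt t"
    have r: "r \<in> {0<..<1}" "r\<^sup>2 = t" using t by (auto simp: r_def)
    have "(V1 has_real_derivative V2 t) (at (r\<^sup>2))"
      using V1[of t] t r by (simp add: at_within_Icc_at)
    moreover have "((\<lambda>r. r\<^sup>2) has_real_derivative 2 * r) (at r)"
      by (auto intro!: derivative_eq_intros)
    ultimately have V: "((\<lambda>r. V1 (r\<^sup>2)) has_real_derivative V2 t * (2 * r)) (at r)"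
      by (rule DERIV_chain2[where f = V1])
    have "2 * (real (Suc n) * r ^ (Suc n - Suc 0)) * V1 (r\<^sup>2) + V2 t * (2 * r) * (2 * r ^ Suc n)
        = r ^ n * (4 * t * V2 t + 2 * (real n + 1) * V1 t)"
      unfolding r(2)[symmetric] by (simp add: algebra_simps power2_eq_square)
    moreover have "(\<lambda>r. 2 * r ^ Suc n * V1 (r\<^sup>2)) = (\<lambda>r. r ^ n * (2 * r * V1 (r\<^sup>2)))"
      by (simp add: fun_eq_iff)
    ultimately have "((\<lambda>r. r ^ n * (2 * r * V1 (r\<^sup>2))) has_real_derivative
        r ^ n * (4 * t * V2 t + 2 * (real n + 1) * V1 t)) (at r)"
      using DERIV_mult[OF DERIV_cmult[OF DERIV_pow[of "Suc n" r], of 2] V] by (simp only:)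
    from DERIV_unique[OF this flux[OF r(1)]]
    show "4 * t * V2 t + 2 * (real n + 1) * V1 t - g t = 0"
      using r by simp
  qed (use t in auto)
  then show ?thesis by simp
qed

lemma primitive_derivative:
  assumes "continuous_on {0..1} f" "t \<in> {0..1::real}"
  shows "((\<lambda>t. integral {0..t} f) has_real_derivative f t) (at t within {0..1})"
  by (rule integral_has_real_derivative[OF assms])

lemma primitive_Ck: "Ck k f \<Longrightarrow> Ck (Suc k) (\<lambda>t. integral {0..t} f)"
  by (rule Ck_antiderivative[OF primitive_derivative[OF Ck_imp_continuous]])

lemma square_chain:
  assumes V: "\<And>t. t \<in> {0..1} \<Longrightarrow> (V has_real_derivative V' t) (at t within {0..1})"
    and r: "r \<in> {0<..<1}"
  shows "((\<lambda>r. V (r\<^sup>2)) has_real_derivative V' (r\<^sup>2) * (2 * r)) (at r)"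
proof (rule DERIV_chain2[where f = V])
  have "0 < r\<^sup>2" "r\<^sup>2 < 1" using r by (auto simp: power_less_one_iff)
  then show "(V has_real_derivative V' (r\<^sup>2)) (at (r\<^sup>2))"
    using V[of "r\<^sup>2"] by (simp add: at_within_Icc_at)
  show "((\<lambda>r. r\<^sup>2) has_real_derivative 2 * r) (at r)"
    by (auto intro!: derivative_eq_intros)
qed

lemma square_continuous:
  "continuous_on {0..1} V \<Longrightarrow> continuous_on {0..1::real} (\<lambda>r. V (r\<^sup>2) :: real)"
  by (rule continuous_on_compose2[of "{0..1}" V]) (auto intro!: continuous_intros simp: power_le_one)

section \<open>The Green operator of the clamped plate\<close>

locale green_operator =
  fixes n :: nat and B T :: real
  assumes B: "0 < B" and T: "0 < T"
begin

definition "h = bessel n (T / B)"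

text \<open>Reduction of order: with w = h z the equation B Laplacian w - T w = f becomes
  (r^n h^2 z')' = r^n h f / B, where the prime is the derivative in r. Integration gives the
  derivative of z in t.\<close>
definition ratio_deriv :: "(real \<Rightarrow> real) \<Rightarrow> real \<Rightarrow> real" where
  "ratio_deriv f t = avg n (\<lambda>t. h t * (f t / B)) t * inverse (2 * (h t * h t))"

definition ratio :: "(real \<Rightarrow> real) \<Rightarrow> real \<Rightarrow> real" where
  "ratio f t = integral {0..t} (ratio_deriv f)"

text \<open>The Laplacian of the solution: a multiple of h is added to h z so that the average over the ball is
  zero, which is the condition on the normal derivative.\<close>
definition green_lap :: "(real \<Rightarrow> real) \<Rightarrow> real \<Rightarrow> real" where
  "green_lap f t = - avg n (\<lambda>t. h t * ratio f t) 1 / avg n h 1 * h t + h t * ratio f t"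

definition green :: "(real \<Rightarrow> real) \<Rightarrow> real \<Rightarrow> real" where
  "green f t = integral {0..t} (\<lambda>t. avg n (green_lap f) t / 2) - integral {0..1} (\<lambda>t. avg n (green_lap f) t / 2)"

lemma ratio_nonneg: "0 \<le> T / B" using B T by simp

lemma h_ge_1: "t \<in> {0..1} \<Longrightarrow> 1 \<le> h t"
  unfolding h_def using bessel_ge_1[OF ratio_nonneg] by simp

lemma h_Ck: "Ck k h"
  unfolding h_def bessel_def[abs_def] by (rule powser_Ck[OF bessel_summable[OF ratio_nonneg]])

lemma ratio_deriv_Ck: "Ck k f \<Longrightarrow> Ck k (ratio_deriv f)"
  unfolding ratio_deriv_def[abs_def] divide_inverse
  by (intro Ck_mult[OF avg_Ck Ck_inverse] Ck_mult[OF h_Ck Ck_mult[OF _ Ck_const]]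
      Ck_mult[OF Ck_const Ck_mult[OF h_Ck h_Ck]])
    (use h_ge_1 in force)+

lemma ratio_Ck: "Ck k f \<Longrightarrow> Ck (Suc k) (ratio f)"
  unfolding ratio_def[abs_def] by (intro primitive_Ck ratio_deriv_Ck)

lemma green_lap_Ck: "Ck k f \<Longrightarrow> Ck (Suc k) (green_lap f)"
  unfolding green_lap_def[abs_def] by (intro Ck_add[OF Ck_mult[OF Ck_const h_Ck] Ck_mult[OF h_Ck ratio_Ck]])

lemma green_derivative:
  assumes "Ck k f" "t \<in> {0..1}"
  shows "(green f has_real_derivative avg n (green_lap f) t / 2) (at t within {0..1})"
proof -
  have "continuous_on {0..1} (\<lambda>t. avg n (green_lap f) t / 2)"
    using Ck_imp_continuous[OF avg_Ck[OF green_lap_Ck[OF assms(1)]], of n] by (intro continuous_intros) auto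
  from DERIV_diff[OF primitive_derivative[OF this assms(2)] DERIV_const] show ?thesis
    by (simp add: green_def[abs_def])
qed

lemma green_Ck:
  assumes "Ck k f"
  shows "Ck (Suc (Suc k)) (green f)"
proof (rule Ck_antiderivative)
  show "Ck (Suc k) (\<lambda>t. avg n (green_lap f) t / 2)"
    unfolding divide_inverse by (intro Ck_mult[OF avg_Ck[OF green_lap_Ck[OF assms]] Ck_const])
qed (rule green_derivative[OF assms])

lemma h_flux:
  obtains h' where "\<And>t. (h has_real_derivative h' t) (at t)"
    "\<And>r. ((\<lambda>r. r ^ n * (2 * r * h' (r\<^sup>2))) has_real_derivative r ^ n * (T / B * h (r\<^sup>2))) (at r)"
proof -
  obtain h1 h2 where h1: "\<And>t. (h has_real_derivative h1 t) (at t)"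
    and h2: "\<And>t. (h1 has_real_derivative h2 t) (at t)"
    and ode: "\<And>t. 4 * t * h2 t + 2 * (real n + 1) * h1 t = T / B * h t"
    using bessel_ode[OF ratio_nonneg, of n] unfolding h_def by metis
  have "((\<lambda>r. r ^ n * (2 * r * h1 (r\<^sup>2))) has_real_derivative r ^ n * (T / B * h (r\<^sup>2))) (at r)" for r
  proof -
    have sq: "((\<lambda>r. r\<^sup>2) has_real_derivative 2 * r) (at r)"
      by (auto intro!: derivative_eq_intros)
    have V: "((\<lambda>r. h1 (r\<^sup>2)) has_real_derivative h2 (r\<^sup>2) * (2 * r)) (at r)"
      by (rule DERIV_chain2[OF h2 sq])
    have "2 * (real (Suc n) * r ^ (Suc n - Suc 0)) * h1 (r\<^sup>2) + h2 (r\<^sup>2) * (2 * r) * (2 * r ^ Suc n)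
        = r ^ n * (4 * r\<^sup>2 * h2 (r\<^sup>2) + 2 * (real n + 1) * h1 (r\<^sup>2))"
      by (simp add: algebra_simps power2_eq_square)
    moreover have "(\<lambda>r. 2 * r ^ Suc n * h1 (r\<^sup>2)) = (\<lambda>r. r ^ n * (2 * r * h1 (r\<^sup>2)))"
      by (simp add: fun_eq_iff)
    ultimately show ?thesis
      using DERIV_mult[OF DERIV_cmult[OF DERIV_pow[of "Suc n" r], of 2] V] unfolding ode by (simp only:)
  qed
  with h1 show thesis by (rule that)
qed

lemma avg_green_lap_1:
  assumes "Ck k f"
  shows "avg n (green_lap f) 1 = 0"
proof -
  have ch: "continuous_on {0..1} h" using Ck_imp_continuous[OF h_Ck] .
  have cz: "continuous_on {0..1} (\<lambda>t. h t * ratio f t)"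
    using Ck_imp_continuous[OF Ck_mult[OF h_Ck ratio_Ck[OF assms]]] .
  have "0 < 1 / (real n + 1)" by simp
  then have "avg n h 1 \<noteq> 0" using avg_lower_bound[OF ch h_ge_1, of n] by linarith
  then show ?thesis
    unfolding green_lap_def[abs_def] by (subst avg_linear[OF ch cz]) auto
qed

text \<open>For merely continuous f the second derivative of w may fail to exist at the centre, but the flux of w is
  differentiable inside the interval. The flux is H (c + z) + A / h, where H is the flux of h and A is
  the primitive of r^n h f / B.\<close>
lemma green_lap_derivative:
  assumes f: "continuous_on {0..1} f"
  obtains w' where "\<And>t. t \<in> {0..1} \<Longrightarrow> (green_lap f has_real_derivative w' t) (at t within {0..1})"
    "continuous_on {0..1} w'"
    "\<And>r. r \<in> {0<..<1} \<Longrightarrow> ((\<lambda>r. r ^ n * (2 * r * w' (r\<^sup>2))) has_real_derivative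
       r ^ n * ((T * green_lap f (r\<^sup>2) + f (r\<^sup>2)) / B)) (at r)"
proof -
  have f0: "Ck 0 f" using f by simp
  obtain h' where h': "\<And>t. (h has_real_derivative h' t) (at t)"
    and hf: "\<And>r. ((\<lambda>r. r ^ n * (2 * r * h' (r\<^sup>2))) has_real_derivative r ^ n * (T / B * h (r\<^sup>2))) (at r)"
    by (rule h_flux, rule that)
  define c where "c = - avg n (\<lambda>t. h t * ratio f t) 1 / avg n h 1"
  have w: "green_lap f t = h t * (c + ratio f t)" for t by (simp add: green_lap_def c_def algebra_simps)
  have h'w: "(h has_real_derivative h' t) (at t within {0..1})" for t
    using has_field_derivative_at_within[OF h'] .
  have z': "(ratio f has_real_derivative ratio_deriv f t) (at t within {0..1})" if "t \<in> {0..1}" for t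
    unfolding ratio_def[abs_def] by (rule primitive_derivative[OF Ck_imp_continuous[OF ratio_deriv_Ck[OF f0]] that])
  define w' where "w' t = h' t * (c + ratio f t) + ratio_deriv f t * h t" for t
  have w': "(green_lap f has_real_derivative w' t) (at t within {0..1})" if "t \<in> {0..1}" for t
    using DERIV_mult[OF h'w DERIV_add[OF DERIV_const z'[OF that]], of c]
    by (simp add: w[abs_def] w'_def)
  show thesis
  proof (rule that)
    show "(green_lap f has_real_derivative w' t) (at t within {0..1})" if "t \<in> {0..1}" for t by (rule w'[OF that])
    obtain v where v: "\<forall>t\<in>{0..1}. (green_lap f has_real_derivative v t) (at t within {0..1})" "continuous_on {0..1} v"
      using green_lap_Ck[OF f0] by auto
    have "w' t = v t" if "t \<in> {0..1}" for t
      using vector_derivative_unique_within_closed_interval[of 0 1 t "green_lap f" "w' t" "v t"] w'[OF that] v(1) that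
      by (simp add: has_real_derivative_iff_has_vector_derivative)
    then show "continuous_on {0..1} w'" using v(2) continuous_on_cong[OF refl, of "{0..1}" w' v] by simp
    fix r :: real assume r: "r \<in> {0<..<1}"
    let ?F = "\<lambda>t. h t * (f t / B)"
    let ?A = "\<lambda>r. r ^ Suc n * avg n ?F (r\<^sup>2)" and ?H = "\<lambda>r. r ^ n * (2 * r * h' (r\<^sup>2))"
    have hr: "h (r\<^sup>2) \<noteq> 0" if "r \<in> {0<..<1}" for r
      using h_ge_1[of "r\<^sup>2"] that by (auto simp: power_le_one)
    have cF: "continuous_on {0..1} ?F"
      using Ck_imp_continuous[OF h_Ck] f B by (intro continuous_intros) auto
    have A': "(?A has_real_derivative r ^ n * ?F (r\<^sup>2)) (at r)"
      by (rule avg_flux[OF cF r])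
    have "((\<lambda>r. ?H r * (c + ratio f (r\<^sup>2)) + ?A r / h (r\<^sup>2)) has_real_derivative
        (r ^ n * (T / B * h (r\<^sup>2)) * (c + ratio f (r\<^sup>2)) + (0 + ratio_deriv f (r\<^sup>2) * (2 * r)) * ?H r)
        + (r ^ n * ?F (r\<^sup>2) * h (r\<^sup>2) - ?A r * (h' (r\<^sup>2) * (2 * r))) / (h (r\<^sup>2) * h (r\<^sup>2))) (at r)"
      by (intro DERIV_add DERIV_mult DERIV_divide DERIV_const hf A' square_chain[OF z' r] square_chain[OF h'w r] hr r)
    moreover have "(r ^ n * (T / B * h (r\<^sup>2)) * (c + ratio f (r\<^sup>2)) + (0 + ratio_deriv f (r\<^sup>2) * (2 * r)) * ?H r)
        + (r ^ n * ?F (r\<^sup>2) * h (r\<^sup>2) - ?A r * (h' (r\<^sup>2) * (2 * r))) / (h (r\<^sup>2) * h (r\<^sup>2))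
        = r ^ n * ((T * green_lap f (r\<^sup>2) + f (r\<^sup>2)) / B)"
      using hr[OF r] B by (simp add: ratio_deriv_def w field_simps power2_eq_square)
    ultimately have *: "((\<lambda>r. ?H r * (c + ratio f (r\<^sup>2)) + ?A r / h (r\<^sup>2)) has_real_derivative
        r ^ n * ((T * green_lap f (r\<^sup>2) + f (r\<^sup>2)) / B)) (at r)"
      by (simp only:)
    show "((\<lambda>r. r ^ n * (2 * r * w' (r\<^sup>2))) has_real_derivative
       r ^ n * ((T * green_lap f (r\<^sup>2) + f (r\<^sup>2)) / B)) (at r)"
    proof (rule has_field_derivative_transform_within_open[OF *])
      show "?H r * (c + ratio f (r\<^sup>2)) + ?A r / h (r\<^sup>2) = r ^ n * (2 * r * w' (r\<^sup>2))"
        if "r \<in> {0<..<1}" for r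
        using hr[OF that] by (simp add: w'_def ratio_deriv_def field_simps)
    qed (use r in auto)
  qed
qed

lemma green_plate:
  assumes f: "continuous_on {0..1} f"
  shows "plate n B T (\<lambda>r. f (r\<^sup>2)) (\<lambda>r. green f (r\<^sup>2))"
proof -
  have f0: "Ck 0 f" using f by simp
  obtain w' where w': "\<And>t. t \<in> {0..1} \<Longrightarrow> (green_lap f has_real_derivative w' t) (at t within {0..1})"
    and cw': "continuous_on {0..1} w'"
    and wf: "\<And>r. r \<in> {0<..<1} \<Longrightarrow> ((\<lambda>r. r ^ n * (2 * r * w' (r\<^sup>2))) has_real_derivative
       r ^ n * ((T * green_lap f (r\<^sup>2) + f (r\<^sup>2)) / B)) (at r)"
    using green_lap_derivative[OF f] by blast
  have cw: "continuous_on {0..1} (green_lap f)" using Ck_imp_continuous[OF green_lap_Ck[OF f0]] .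
  have "plate_system n B T (\<lambda>r. f (r\<^sup>2)) (\<lambda>r. green f (r\<^sup>2)) (\<lambda>r. r ^ Suc n * avg n (green_lap f) (r\<^sup>2))
    (\<lambda>r. green_lap f (r\<^sup>2)) (\<lambda>r. r ^ n * (2 * r * w' (r\<^sup>2)))"
  proof
    show "continuous_on {0..1} (\<lambda>r. green f (r\<^sup>2))"
      by (rule square_continuous[OF Ck_imp_continuous[OF green_Ck[OF f0]]])
    show "continuous_on {0..1} (\<lambda>r. r ^ Suc n * avg n (green_lap f) (r\<^sup>2))"
      by (intro continuous_intros square_continuous avg_continuous cw)
    show "continuous_on {0..<1} (\<lambda>r. green_lap f (r\<^sup>2))"
      by (rule continuous_on_subset[OF square_continuous[OF cw]]) auto
    have "continuous_on {0..1} (\<lambda>r. r ^ n * (2 * r * w' (r\<^sup>2)))"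
      by (intro continuous_intros square_continuous cw')
    then show "continuous_on {0..<1} (\<lambda>r. r ^ n * (2 * r * w' (r\<^sup>2)))"
      by (rule continuous_on_subset) auto
    show "1 ^ Suc n * avg n (green_lap f) (1\<^sup>2) = 0" using avg_green_lap_1[OF f0] by simp
    show "green f (1\<^sup>2) = 0" by (simp add: green_def)
    fix r :: real assume r: "r \<in> {0<..<1}"
    show "((\<lambda>r. green f (r\<^sup>2)) has_real_derivative r ^ Suc n * avg n (green_lap f) (r\<^sup>2) / r ^ n) (at r)"
      using square_chain[OF green_derivative[OF f0] r] r by (simp add: mult.commute)
    show "((\<lambda>r. r ^ Suc n * avg n (green_lap f) (r\<^sup>2)) has_real_derivative r ^ n * green_lap f (r\<^sup>2)) (at r)"
      by (rule avg_flux[OF cw r])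
    show "((\<lambda>r. green_lap f (r\<^sup>2)) has_real_derivative r ^ n * (2 * r * w' (r\<^sup>2)) / r ^ n) (at r)"
      using square_chain[OF w' r] r by (simp add: mult.commute)
  qed (use wf in auto)
  then show ?thesis unfolding plate_def by blast
qed

text \<open>One derivative of f is enough for both second-order equations to hold pointwise, including at the
  centre t = 0.\<close>
lemma green_ode:
  assumes f: "Ck 1 f"
  obtains u1 u2 w1 w2 where
    "\<And>t. t \<in> {0..1} \<Longrightarrow> (green f has_real_derivative u1 t) (at t within {0..1})"
    "\<And>t. t \<in> {0..1} \<Longrightarrow> (u1 has_real_derivative u2 t) (at t within {0..1})"
    "\<And>t. t \<in> {0..1} \<Longrightarrow> 4 * t * u2 t + 2 * (real n + 1) * u1 t = green_lap f t"
    "\<And>t. t \<in> {0..1} \<Longrightarrow> (green_lap f has_real_derivative w1 t) (at t within {0..1})"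
    "\<And>t. t \<in> {0..1} \<Longrightarrow> (w1 has_real_derivative w2 t) (at t within {0..1})"
    "\<And>t. t \<in> {0..1} \<Longrightarrow> 4 * t * w2 t + 2 * (real n + 1) * w1 t = (T * green_lap f t + f t) / B"
    "u1 1 = 0"
proof -
  have cf: "continuous_on {0..1} f" using Ck_imp_continuous[OF f] .
  have cw: "continuous_on {0..1} (green_lap f)" using Ck_imp_continuous[OF green_lap_Ck[OF f]] .
  define u1 where "u1 t = avg n (green_lap f) t / 2" for t
  have "Ck (Suc 0) u1"
    unfolding u1_def[abs_def] divide_inverse
    by (rule Ck_mult[OF avg_Ck[OF Ck_SucD[OF green_lap_Ck[OF f[unfolded One_nat_def]]]] Ck_const])
  then obtain u2 where u2: "\<And>t. t \<in> {0..1} \<Longrightarrow> (u1 has_real_derivative u2 t) (at t within {0..1})"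
      and "Ck 0 u2"
    by (rule Ck_SucE) (rule that)
  then have cu2: "continuous_on {0..1} u2" by simp
  obtain w1 where w1: "\<And>t. t \<in> {0..1} \<Longrightarrow> (green_lap f has_real_derivative w1 t) (at t within {0..1})"
      and C1: "Ck (Suc 0) w1"
    using green_lap_Ck[OF f[unfolded One_nat_def]] by (rule Ck_SucE) (rule that)
  obtain w2 where w2: "\<And>t. t \<in> {0..1} \<Longrightarrow> (w1 has_real_derivative w2 t) (at t within {0..1})"
      and "Ck 0 w2"
    using C1 by (rule Ck_SucE) (rule that)
  then have cw2: "continuous_on {0..1} w2" by simp
  obtain w' where w': "\<And>t. t \<in> {0..1} \<Longrightarrow> (green_lap f has_real_derivative w' t) (at t within {0..1})"
    and "continuous_on {0..1} w'"
    and wf: "\<And>r. r \<in> {0<..<1} \<Longrightarrow> ((\<lambda>r. r ^ n * (2 * r * w' (r\<^sup>2))) has_real_derivative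
       r ^ n * ((T * green_lap f (r\<^sup>2) + f (r\<^sup>2)) / B)) (at r)"
    by (rule green_lap_derivative[OF cf]) (rule that)
  have ww: "w' t = w1 t" if "t \<in> {0..1}" for t
    using vector_derivative_unique_within_closed_interval[of 0 1 t "green_lap f" "w' t" "w1 t"] w'[OF that] w1[OF that] that
    by (simp add: has_real_derivative_iff_has_vector_derivative)
  show thesis
  proof (rule that)
    show "(green f has_real_derivative u1 t) (at t within {0..1})" if "t \<in> {0..1}" for t
      unfolding u1_def by (rule green_derivative[OF f that])
    show "4 * t * u2 t + 2 * (real n + 1) * u1 t = green_lap f t" if "t \<in> {0..1}" for t
    proof (rule radial_ode[OF u2 cu2 cw _ that])
      show "((\<lambda>r. r ^ n * (2 * r * u1 (r\<^sup>2))) has_real_derivative r ^ n * green_lap f (r\<^sup>2)) (at r)"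
        if "r \<in> {0<..<1}" for r
        using avg_flux[OF cw that, of n] by (simp add: u1_def mult_ac)
    qed
    show "4 * t * w2 t + 2 * (real n + 1) * w1 t = (T * green_lap f t + f t) / B" if "t \<in> {0..1}" for t
    proof (rule radial_ode[OF w2 cw2 _ _ that])
      show "continuous_on {0..1} (\<lambda>t. (T * green_lap f t + f t) / B)"
        using B by (intro continuous_intros cw cf) auto
      show "((\<lambda>r. r ^ n * (2 * r * w1 (r\<^sup>2))) has_real_derivative
          r ^ n * ((T * green_lap f (r\<^sup>2) + f (r\<^sup>2)) / B)) (at r)" if r: "r \<in> {0<..<1}" for r
      proof (rule has_field_derivative_transform_within_open[OF wf[OF r]])
        show "r ^ n * (2 * r * w' (r\<^sup>2)) = r ^ n * (2 * r * w1 (r\<^sup>2))" if "r \<in> {0<..<1}" for r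
          using ww[of "r\<^sup>2"] that by (simp add: power_le_one)
      qed (use r in auto)
    qed
    show "u1 1 = 0" using avg_green_lap_1[OF f] by (simp add: u1_def)
  qed (fact u2 w1 w2)+
qed

text \<open>The constant depends on n, B and T only. It serves twice: as an a priori bound for the fixed point
  argument and, since green f vanishes at 1, as a bound of the solution by its load.\<close>
lemma green_lipschitz:
  "\<exists>C>0. \<forall>f K. continuous_on {0..1} f \<longrightarrow> (\<forall>t\<in>{0..1}. \<bar>f t\<bar> \<le> K) \<longrightarrow> (C * K)-lipschitz_on {0..1} (green f)"
proof -
  have ch: "continuous_on {0..1} h" using Ck_imp_continuous[OF h_Ck] .
  have "{0..1::real} \<noteq> {}" by simp
  from continuous_attains_sup[OF compact_Icc this ch]
  obtain s where "\<forall>t\<in>{0..1}. h t \<le> h s" by blast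
  then have M: "h t \<le> h s" if "t \<in> {0..1}" for t using that by blast
  define M where "M = h s"
  note M = M[folded M_def]
  have M1: "1 \<le> M" using h_ge_1[of 0] M[of 0] by simp
  have h_abs: "\<bar>h t\<bar> \<le> M" if "t \<in> {0..1}" for t using h_ge_1[OF that] M[OF that] by simp
  \<comment> \<open>The bounds below: the load, z' and z contribute M K / B, the normalising constant (n + 1) M^2 K / B.\<close>
  define C where "C = (M * ((real n + 1) * (M * M)) + M * M) / B"
  have C: "0 < C" 
  proof -
    have "0 < M" using M1 by simp
    then have "0 < M * ((real n + 1) * (M * M)) + M * M" by (simp add: add_nonneg_pos)
    then show ?thesis unfolding C_def by (rule divide_pos_pos[OF _ B])
  qed
  show ?thesis
  proof (intro exI[of _ C] conjI allI impI C)
    fix f :: "real \<Rightarrow> real" and K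
    assume f: "continuous_on {0..1} f" and "\<forall>t\<in>{0..1}. \<bar>f t\<bar> \<le> K"
    then have K: "\<bar>f t\<bar> \<le> K" if "t \<in> {0..1}" for t using that by blast
    have f0: "Ck 0 f" using f by simp
    have K0: "0 \<le> K" using K[of 0] by simp
    let ?F = "\<lambda>t. h t * (f t / B)"
    have cF: "continuous_on {0..1} ?F" using ch f B by (intro continuous_intros) auto
    have F: "\<bar>?F t\<bar> \<le> M * (K / B)" if "t \<in> {0..1}" for t
    proof -
      have "\<bar>f t / B\<bar> \<le> K / B" using divide_right_mono[OF K[OF that], of B] B by simp
      then show ?thesis
        unfolding abs_mult by (rule mult_mono[OF h_abs[OF that]]) (use M1 in simp_all)
    qed
    have z1: "\<bar>ratio_deriv f t\<bar> \<le> M * (K / B)" if t: "t \<in> {0..1}" for t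
    proof -
      have "1 * 1 \<le> h t * h t" using h_ge_1[OF t] by (intro mult_mono) auto
      then have "1 \<le> 2 * (h t * h t)" by linarith
      from le_imp_inverse_le[OF this] this
      have "inverse (2 * (h t * h t)) \<le> 1" "0 \<le> inverse (2 * (h t * h t))" by simp_all
      then have "\<bar>avg n ?F t\<bar> * \<bar>inverse (2 * (h t * h t))\<bar> \<le> M * (K / B) * 1"
        using avg_bound[OF cF F t, of n] B K0 M1 by (intro mult_mono) auto
      then show ?thesis unfolding ratio_deriv_def abs_mult by simp
    qed
    have z: "\<bar>ratio f t\<bar> \<le> M * (K / B)" if t: "t \<in> {0..1}" for t
    proof -
      have "norm (integral {0..t} (ratio_deriv f)) \<le> M * (K / B) * (t - 0)"
        by (rule integral_bound)
           (use t z1 continuous_on_subset[OF Ck_imp_continuous[OF ratio_deriv_Ck[OF f0]]] in auto)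
      also have "\<dots> \<le> M * (K / B) * 1" using t K0 M1 B by (intro mult_left_mono) auto
      finally show ?thesis by (simp add: ratio_def)
    qed
    have chz: "continuous_on {0..1} (\<lambda>t. h t * ratio f t)"
      using Ck_imp_continuous[OF Ck_mult[OF h_Ck ratio_Ck[OF f0]]] .
    have hz: "\<bar>h t * ratio f t\<bar> \<le> M * (M * (K / B))" if "t \<in> {0..1}" for t
      unfolding abs_mult using z[OF that] h_abs[OF that] M1 by (intro mult_mono) auto
    have c: "\<bar>- avg n (\<lambda>t. h t * ratio f t) 1 / avg n h 1\<bar> \<le> (real n + 1) * (M * (M * (K / B)))"
    proof -
      have a: "1 / (real n + 1) \<le> avg n h 1" by (rule avg_lower_bound[OF ch h_ge_1])
      moreover have "0 < 1 / (real n + 1)" by simp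
      ultimately have pos: "0 < avg n h 1" by linarith
      have "\<bar>- avg n (\<lambda>t. h t * ratio f t) 1 / avg n h 1\<bar> = \<bar>avg n (\<lambda>t. h t * ratio f t) 1\<bar> * (1 / avg n h 1)"
        using pos by (simp add: abs_divide)
      also have "\<dots> \<le> (M * (M * (K / B))) * (real n + 1)"
      proof (rule mult_mono)
        show "1 / avg n h 1 \<le> real n + 1" using a pos by (simp add: field_simps)
      qed (use avg_bound[OF chz hz, of 1 n] pos K0 M1 B in auto)
      finally show ?thesis by (simp add: mult.commute)
    qed
    have w: "\<bar>green_lap f t\<bar> \<le> C * K" if "t \<in> {0..1}" for t
    proof -
      have "\<bar>green_lap f t\<bar> \<le> \<bar>- avg n (\<lambda>t. h t * ratio f t) 1 / avg n h 1\<bar> * \<bar>h t\<bar> + \<bar>h t * ratio f t\<bar>"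
        unfolding green_lap_def abs_mult[symmetric] by (rule abs_triangle_ineq)
      also have "\<dots> \<le> ((real n + 1) * (M * (M * (K / B)))) * M + M * (M * (K / B))"
        using c hz[OF that] h_abs[OF that] K0 M1 B by (intro add_mono mult_mono) auto
      also have "\<dots> = C * K" by (simp add: C_def divide_inverse algebra_simps)
      finally show ?thesis .
    qed
    have cw: "continuous_on {0..1} (green_lap f)" using Ck_imp_continuous[OF green_lap_Ck[OF f0]] .
    have CK: "0 \<le> C * K" using C K0 by simp
    show "(C * K)-lipschitz_on {0..1} (green f)"
    proof (rule lipschitz_onI)
      fix x y :: real assume "x \<in> {0..1}" "y \<in> {0..1}"
      then have "norm (green f x - green f y) \<le> C * K * norm (x - y)"
      proof (intro field_differentiable_bound[OF _ green_derivative[OF f0]])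
        show "norm (avg n (green_lap f) t / 2) \<le> C * K" if "t \<in> {0..1}" for t
          using avg_bound[OF cw w that, of n] CK by simp
      qed auto
      then show "dist (green f x) (green f y) \<le> C * K * dist x y" by (simp add: dist_norm)
    qed (rule CK)
  qed
qed

end

section \<open>The largest fixed point\<close>

text \<open>The Knaster-Tarski argument. Continuous functions with values in [m, 0] do not form a complete
  lattice, but the K-Lipschitz ones do, and A maps into them as long as its values stay above m; the supremum is therefore taken over Lipschitz v with v \<open>\<le>\<close> A v.
  A merely continuous v with v \<open>\<le>\<close> A v is compared with its image A v, which is Lipschitz.\<close>
lemma greatest_fixed_point:
  fixes A :: "(real \<Rightarrow> real) \<Rightarrow> real \<Rightarrow> real" and m K :: real
  defines "adm \<equiv> \<lambda>v. continuous_on {0..1} v \<and> (\<forall>t\<in>{0..1}. m \<le> v t \<and> v t \<le> 0)"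
  assumes mono: "\<And>v w t. adm v \<Longrightarrow> adm w \<Longrightarrow> (\<And>t. t \<in> {0..1} \<Longrightarrow> v t \<le> w t) \<Longrightarrow> t \<in> {0..1} \<Longrightarrow> A v t \<le> A w t"
    and nonpos: "\<And>v t. adm v \<Longrightarrow> t \<in> {0..1} \<Longrightarrow> A v t \<le> 0"
    and lip: "\<And>v. adm v \<Longrightarrow> K-lipschitz_on {0..1} (A v)"
    and s: "adm s" "\<And>t. t \<in> {0..1} \<Longrightarrow> s t \<le> A s t"
  shows "\<exists>U. adm U \<and> (\<forall>t\<in>{0..1}. U t = A U t) \<and>
    (\<forall>v. adm v \<longrightarrow> (\<forall>t\<in>{0..1}. v t \<le> A v t) \<longrightarrow> (\<forall>t\<in>{0..1}. v t \<le> U t))"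
proof -
  define S where "S = {v. adm v \<and> K-lipschitz_on {0..1} v \<and> (\<forall>t\<in>{0..1}. v t \<le> A v t)}"
  define U where "U t = (SUP v\<in>S. v t)" for t
  have step: "A v \<in> S" if v: "adm v" "\<And>t. t \<in> {0..1} \<Longrightarrow> v t \<le> A v t" for v
  proof -
    have "m \<le> A v t" if "t \<in> {0..1}" for t
      using v(1) v(2)[OF that] that unfolding adm_def by force
    then have "adm (A v)"
      using lipschitz_on_continuous_on[OF lip[OF v(1)]] nonpos[OF v(1)] by (simp add: adm_def)
    then show ?thesis
      using lip[OF v(1)] mono[OF v(1) _ v(2)] by (simp add: S_def)
  qed
  have ne: "S \<noteq> {}" using step[OF s] by blast
  have bdd: "bdd_above ((\<lambda>v. v t) ` S)" if "t \<in> {0..1}" for t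
    using that by (intro bdd_aboveI2[of _ _ 0]) (auto simp: S_def adm_def)
  have upper: "v t \<le> U t" if "v \<in> S" "t \<in> {0..1}" for v t
    unfolding U_def by (rule cSUP_upper[OF that(1) bdd[OF that(2)]])
  have least: "U t \<le> c" if "\<And>v. v \<in> S \<Longrightarrow> v t \<le> c" for t c
    unfolding U_def by (rule cSUP_least[OF ne that])
  have K: "0 \<le> K" using lipschitz_on_nonneg[OF lip[OF s(1)]] .
  have U_le: "U x \<le> U y + K * \<bar>x - y\<bar>" if xy: "x \<in> {0..1}" "y \<in> {0..1}" for x y
  proof (rule least)
    fix v assume v: "v \<in> S"
    then have "dist (v x) (v y) \<le> K * dist x y"
      using lipschitz_onD[of K "{0..1}" v x y] xy by (simp add: S_def)
    then show "v x \<le> U y + K * \<bar>x - y\<bar>"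
      using upper[OF v xy(2)] by (simp add: dist_real_def abs_le_iff)
  qed
  have lipU: "K-lipschitz_on {0..1} U"
  proof (rule lipschitz_onI[OF _ K])
    show "dist (U x) (U y) \<le> K * dist x y" if "x \<in> {0..1}" "y \<in> {0..1}" for x y
      using U_le[OF that] U_le[OF that(2,1)] by (simp add: dist_real_def abs_le_iff abs_minus_commute)
  qed
  have "m \<le> U t \<and> U t \<le> 0" if t: "t \<in> {0..1}" for t
  proof
    have "m \<le> A s t" using step[OF s] t by (simp add: S_def adm_def)
    also have "\<dots> \<le> U t" by (rule upper[OF step[OF s] t])
    finally show "m \<le> U t" .
    show "U t \<le> 0" by (rule least) (use t in \<open>auto simp: S_def adm_def\<close>)
  qed
  then have admU: "adm U"
    using lipschitz_on_continuous_on[OF lipU] by (simp add: adm_def)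
  have U_AU: "U t \<le> A U t" if t: "t \<in> {0..1}" for t
  proof (rule least)
    fix v assume v: "v \<in> S"
    then have "adm v" "v t \<le> A v t" using t by (auto simp: S_def)
    note this(2)
    also have "A v t \<le> A U t" using mono[OF \<open>adm v\<close> admU upper[OF v] t] .
    finally show "v t \<le> A U t" .
  qed
  show ?thesis
  proof (intro exI[of _ U] conjI ballI allI impI admU)
    show "U t = A U t" if t: "t \<in> {0..1}" for t
      using U_AU[OF t] upper[OF step[OF admU U_AU] t] by simp
    fix v t assume v: "adm v" "\<forall>t\<in>{0..1}. v t \<le> A v t" and t: "t \<in> {0..1::real}"
    have "v t \<le> A v t" "A v t \<le> U t"
      using v(2) t upper[OF step[OF v(1)] t] by blast+
    then show "v t \<le> U t" by simp
  qed
qed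

context green_operator
begin

lemma plate_le_green:
  assumes p: "plate n B T f \<phi>" and k: "continuous_on {0..1} k"
    and le: "\<And>r. r \<in> {0<..<1} \<Longrightarrow> f r \<le> k (r\<^sup>2)" and r: "r \<in> {0..1}"
  shows "\<phi> r \<le> green k (r\<^sup>2)"
  by (rule plate_le[OF B T p green_plate[OF k] le r])

lemma green_mono:
  assumes "continuous_on {0..1} f" "continuous_on {0..1} k"
    and "\<And>t. t \<in> {0..1} \<Longrightarrow> f t \<le> k t" and t: "t \<in> {0..1}"
  shows "green f t \<le> green k t"
proof -
  have "green f ((sqrt t)\<^sup>2) \<le> green k ((sqrt t)\<^sup>2)"
    by (rule plate_le[OF B T green_plate[OF assms(1)] green_plate[OF assms(2)]])
       (use assms(3) t in \<open>auto simp: power_le_one\<close>)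
  then show ?thesis using t by simp
qed

lemma green_nonpos:
  assumes "continuous_on {0..1} f" "\<And>t. t \<in> {0..1} \<Longrightarrow> f t \<le> 0" and t: "t \<in> {0..1}"
  shows "green f t \<le> 0"
proof -
  have "green f ((sqrt t)\<^sup>2) \<le> 0"
    by (rule plate_nonpos[OF B T green_plate[OF assms(1)]])
       (use assms(2) t in \<open>auto simp: power_le_one\<close>)
  then show ?thesis using t by simp
qed

end

section \<open>The nonlinear problem in the variable t\<close>

locale mems_problem = green_operator +
  fixes J :: "real set" and g :: "real \<Rightarrow> real"
  assumes J: "open J" "is_interval J" "0 \<in> J"
    and g: "C_on 2 J g" and g_nonneg: "\<forall>s\<in>J. 0 \<le> g s" and g_mono: "antimono_on J g" and g0: "0 < g 0"
begin

abbreviation "load l v \<equiv> (\<lambda>t. - l * g (v t))"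

definition subsolution_1d :: "real \<Rightarrow> (real \<Rightarrow> real) \<Rightarrow> bool" where
  "subsolution_1d l v \<longleftrightarrow> continuous_on {0..1} v \<and>
     (\<forall>t\<in>{0..1}. v t \<in> J \<and> v t \<le> 0 \<and> v t \<le> green (load l v) t)"

lemma g_le: "s \<in> J \<Longrightarrow> t \<in> J \<Longrightarrow> s \<le> t \<Longrightarrow> g t \<le> g s"
  using monotone_onD[OF g_mono] by blast

lemma load_continuous:
  assumes "continuous_on {0..1} v" "\<And>t. t \<in> {0..1} \<Longrightarrow> v t \<in> J"
  shows "continuous_on {0..1} (load l v)"
proof -
  have "continuous_on {0..1} (\<lambda>t. g (v t))"
    by (rule continuous_on_compose2[OF C_on_imp_continuous[OF g] assms(1)]) (use assms(2) in blast)
  then show ?thesis by (intro continuous_intros)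
qed

lemma green_load_mono:
  assumes l: "0 \<le> l" and "continuous_on {0..1} v" "\<And>t. t \<in> {0..1} \<Longrightarrow> v t \<in> J"
    and "continuous_on {0..1} u" "\<And>t. t \<in> {0..1} \<Longrightarrow> u t \<in> J"
    and le: "\<And>t. t \<in> {0..1} \<Longrightarrow> v t \<le> u t" and t: "t \<in> {0..1}"
  shows "green (load l v) t \<le> green (load l u) t"
proof (rule green_mono[OF _ _ _ t])
  show "- l * g (v t) \<le> - l * g (u t)" if "t \<in> {0..1}" for t
    using mult_left_mono[OF g_le[OF assms(3,5) le, OF that that that] l] by simp
qed (intro load_continuous assms; assumption)+

lemma green_load_nonpos:
  assumes l: "0 \<le> l" and v: "continuous_on {0..1} v" "\<And>t. t \<in> {0..1} \<Longrightarrow> v t \<in> J" and t: "t \<in> {0..1}"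
  shows "green (load l v) t \<le> 0"
proof (rule green_nonpos[OF load_continuous[OF v] _ t])
  show "- l * g (v t) \<le> 0" if "t \<in> {0..1}" for t
    using g_nonneg v(2)[OF that] l by simp
qed

text \<open>The given subsolution s supplies the lower bound m that keeps all functions in a compact part of J,
  and with it the Lipschitz constant. A competitor v may fall below m; it is replaced by max(v, s),
  which is again below its image because the operator is monotone.\<close>
lemma maximal_subsolution_1d:
  assumes l: "0 \<le> l" and s: "subsolution_1d l s"
  obtains U where "subsolution_1d l U" "\<And>t. t \<in> {0..1} \<Longrightarrow> U t = green (load l U) t"
    "\<And>v t. subsolution_1d l v \<Longrightarrow> t \<in> {0..1} \<Longrightarrow> v t \<le> U t"
proof -
  have sc: "continuous_on {0..1} s" and sJ: "\<And>t. t \<in> {0..1} \<Longrightarrow> s t \<in> J"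
    and s0: "\<And>t. t \<in> {0..1} \<Longrightarrow> s t \<le> 0" and sg: "\<And>t. t \<in> {0..1} \<Longrightarrow> s t \<le> green (load l s) t"
    using s by (auto simp: subsolution_1d_def)
  have "{0..1::real} \<noteq> {}" by simp
  from continuous_attains_inf[OF compact_Icc this sc]
  obtain p where p: "p \<in> {0..1}" and pmin: "\<forall>t\<in>{0..1}. s p \<le> s t" by blast
  define m where "m = s p"
  have mJ: "m \<in> J" using sJ[OF p] by (simp add: m_def)
  have ms: "m \<le> s t" if "t \<in> {0..1}" for t using pmin that by (simp add: m_def)
  have inJ: "x \<in> J" if "m \<le> x" "x \<le> 0" for x
    using mem_is_interval_1_I[OF J(2) mJ J(3) that] .
  obtain C where "0 < C" and lip: "\<forall>f K. continuous_on {0..1} f \<longrightarrow> (\<forall>t\<in>{0..1}. \<bar>f t\<bar> \<le> K)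
      \<longrightarrow> (C * K)-lipschitz_on {0..1} (green f)"
    using green_lipschitz by blast
  have "\<exists>U. (continuous_on {0..1} U \<and> (\<forall>t\<in>{0..1}. m \<le> U t \<and> U t \<le> 0)) \<and>
    (\<forall>t\<in>{0..1}. U t = green (load l U) t) \<and>
    (\<forall>v. continuous_on {0..1} v \<and> (\<forall>t\<in>{0..1}. m \<le> v t \<and> v t \<le> 0) \<longrightarrow>
      (\<forall>t\<in>{0..1}. v t \<le> green (load l v) t) \<longrightarrow> (\<forall>t\<in>{0..1}. v t \<le> U t))"
  proof (rule greatest_fixed_point[of m "\<lambda>v. green (load l v)" "C * (l * g m)" s])
    fix v w :: "real \<Rightarrow> real" and t :: real
    assume v: "continuous_on {0..1} v \<and> (\<forall>t\<in>{0..1}. m \<le> v t \<and> v t \<le> 0)"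
    then have vJ: "\<And>t. t \<in> {0..1} \<Longrightarrow> v t \<in> J" using inJ by blast
    have vc: "continuous_on {0..1} v" using v by blast
    show "(C * (l * g m))-lipschitz_on {0..1} (green (load l v))"
    proof (rule lip[rule_format, OF load_continuous[OF vc vJ]])
      fix t :: real assume t: "t \<in> {0..1}"
      have "0 \<le> g (v t)" "g (v t) \<le> g m"
        using g_nonneg vJ[OF t] g_le[OF mJ vJ[OF t]] v t by auto
      then show "\<bar>- l * g (v t)\<bar> \<le> l * g m"
        using l by (simp add: abs_mult mult_left_mono)
    qed
    show "green (load l v) t \<le> 0" if "t \<in> {0..1}"
      by (rule green_load_nonpos[OF l vc vJ that])
    show "green (load l v) t \<le> green (load l w) t"
      if w: "continuous_on {0..1} w \<and> (\<forall>t\<in>{0..1}. m \<le> w t \<and> w t \<le> 0)"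
        and le: "\<And>t. t \<in> {0..1} \<Longrightarrow> v t \<le> w t" and t: "t \<in> {0..1}"
    proof (rule green_load_mono[OF l vc vJ _ _ le t])
      show "continuous_on {0..1} w" "\<And>t. t \<in> {0..1} \<Longrightarrow> w t \<in> J" using w inJ by blast+
    qed
  next
    show "continuous_on {0..1} s \<and> (\<forall>t\<in>{0..1}. m \<le> s t \<and> s t \<le> 0)" using sc ms s0 by blast
  next
    show "s t \<le> green (load l s) t" if "t \<in> {0..1}" for t by (rule sg[OF that])
  qed
  then obtain U where U: "continuous_on {0..1} U \<and> (\<forall>t\<in>{0..1}. m \<le> U t \<and> U t \<le> 0)"
    and fixed: "\<forall>t\<in>{0..1}. U t = green (load l U) t"
    and greatest: "\<forall>v. continuous_on {0..1} v \<and> (\<forall>t\<in>{0..1}. m \<le> v t \<and> v t \<le> 0) \<longrightarrow>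
      (\<forall>t\<in>{0..1}. v t \<le> green (load l v) t) \<longrightarrow> (\<forall>t\<in>{0..1}. v t \<le> U t)"
    by blast
  have Uc: "continuous_on {0..1} U" and UJ: "\<And>t. t \<in> {0..1} \<Longrightarrow> U t \<in> J"
    using U inJ by blast+
  show thesis
  proof (rule that[of U])
    show "subsolution_1d l U"
      unfolding subsolution_1d_def using U UJ fixed by simp
    show "U t = green (load l U) t" if "t \<in> {0..1}" for t using fixed that by blast
    fix v t assume v: "subsolution_1d l v" and t: "t \<in> {0..1::real}"
    have vc: "continuous_on {0..1} v" and vJ: "\<And>t. t \<in> {0..1} \<Longrightarrow> v t \<in> J"
      and v0: "\<And>t. t \<in> {0..1} \<Longrightarrow> v t \<le> 0" and vg: "\<And>t. t \<in> {0..1} \<Longrightarrow> v t \<le> green (load l v) t"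
      using v by (auto simp: subsolution_1d_def)
    let ?x = "\<lambda>t. max (v t) (s t)"
    have xc: "continuous_on {0..1} ?x" by (intro continuous_intros vc sc)
    have xm: "m \<le> ?x t \<and> ?x t \<le> 0" if "t \<in> {0..1}" for t
      using ms[OF that] v0[OF that] s0[OF that] by auto
    have xJ: "?x t \<in> J" if "t \<in> {0..1}" for t using inJ xm[OF that] by blast
    have "?x t \<le> U t"
    proof (rule greatest[rule_format, OF _ _ t])
      show "?x t \<le> green (load l ?x) t" if t: "t \<in> {0..1}" for t
      proof -
        have "green (load l v) t \<le> green (load l ?x) t" "green (load l s) t \<le> green (load l ?x) t"
          by (rule green_load_mono[OF l vc vJ xc xJ _ t], assumption, assumption, simp,
              rule green_load_mono[OF l sc sJ xc xJ _ t], assumption, assumption, simp)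
        then show ?thesis using vg[OF t] sg[OF t] by simp
      qed
    qed (use xc xm in blast)
    then show "v t \<le> U t" by simp
  qed
qed

text \<open>Take the solution s of the linear problem with constant right-hand side - l M, where M = g(-\<open>\<delta>\<close>).
  If l is small, s stays above -\<open>\<delta>\<close>; then g(s) \<open>\<le>\<close> M, so that s is a subsolution.\<close>
lemma small_load_subsolution: "\<exists>l>0. \<exists>s. subsolution_1d l s"
proof -
  obtain \<epsilon> where \<epsilon>: "0 < \<epsilon>" "ball 0 \<epsilon> \<subseteq> J"
    using J(1,3) open_contains_ball by blast
  define \<delta> where "\<delta> = \<epsilon> / 2"
  have \<delta>: "0 < \<delta>" using \<epsilon>(1) by (simp add: \<delta>_def)
  have inJ: "x \<in> J" if "- \<delta> \<le> x" "x \<le> 0" for x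
    using \<epsilon> that by (intro subsetD[OF \<epsilon>(2)]) (auto simp: \<delta>_def dist_real_def)
  define M where "M = g (- \<delta>)"
  have M: "0 < M" using g_le[OF inJ J(3), of "- \<delta>"] g0 \<delta> by (simp add: M_def)
  obtain C where C: "0 < C" and lip: "\<forall>f K. continuous_on {0..1} f \<longrightarrow> (\<forall>t\<in>{0..1}. \<bar>f t\<bar> \<le> K)
      \<longrightarrow> (C * K)-lipschitz_on {0..1} (green f)"
    using green_lipschitz by blast
  \<comment> \<open>The load for which the Lipschitz bound C (l M) equals \<delta>.\<close>
  define l where "l = \<delta> / (C * M)"
  have l: "0 < l" using \<delta> C M by (simp add: l_def)
  define s where "s = green (\<lambda>_. - l * M)"
  have "(C * (l * M))-lipschitz_on {0..1} s"
    unfolding s_def by (rule lip[rule_format]) (use l M in \<open>auto simp: abs_mult\<close>)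
  moreover have "C * (l * M) = \<delta>" using C M by (simp add: l_def)
  ultimately have L: "\<delta>-lipschitz_on {0..1} s" by simp
  have s1: "s 1 = 0" by (simp add: s_def green_def)
  have s: "- \<delta> \<le> s t" "s t \<le> 0" if t: "t \<in> {0..1}" for t
  proof -
    have "\<bar>s t\<bar> \<le> \<delta> * \<bar>t - 1\<bar>" using lipschitz_onD[OF L t, of 1] s1 by (simp add: dist_real_def)
    also have "\<dots> \<le> \<delta> * 1" using t \<delta> by (intro mult_left_mono) auto
    finally show "- \<delta> \<le> s t" by simp
    show "s t \<le> 0" unfolding s_def using l M t by (intro green_nonpos) auto
  qed
  have sJ: "s t \<in> J" if "t \<in> {0..1}" for t using inJ s[OF that] by blast
  have sc: "continuous_on {0..1} s" by (rule lipschitz_on_continuous_on[OF L])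
  have "s t \<le> green (load l s) t" if t: "t \<in> {0..1}" for t
    unfolding s_def
  proof (rule green_mono[OF _ _ _ t])
    show "continuous_on {0..1} (load l (green (\<lambda>_. - l * M)))"
      using load_continuous[OF sc sJ] by (simp add: s_def)
    show "- l * M \<le> - l * g (green (\<lambda>_. - l * M) t)" if "t \<in> {0..1}" for t
      using g_le[OF inJ sJ[OF that] s(1)[OF that]] \<delta> l unfolding M_def s_def by simp
  qed simp
  then have "subsolution_1d l s" using sc sJ s by (simp add: subsolution_1d_def)
  with l show ?thesis by blast
qed

end

section \<open>The nonlinear problem on the ball\<close>

lemma open_above_Inf:
  fixes J :: "real set"
  assumes "open J" "bdd_below J" "x \<in> J"
  shows "Inf J < x"
proof -
  obtain d where d: "0 < d" "ball x d \<subseteq> J" using assms(1,3) by (rule openE)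
  then have "x - d / 2 \<in> J" by (intro subsetD[OF d(2)]) (auto simp: dist_real_def)
  then have "Inf J \<le> x - d / 2" by (rule cInf_lower[OF _ assms(2)])
  with d(1) show ?thesis by simp
qed

lemma solution_imp_subsolution:
  "radially_symmetric u \<Longrightarrow> classical_solution J g B T l u \<Longrightarrow> radial_classical_subsolution J g B T l u"
  unfolding classical_solution_def radial_classical_subsolution_def by simp

lemma radially_symmetric_axis:
  assumes "radially_symmetric s" "e \<in> Basis" "x \<in> cball 0 1"
  shows "s x = s (norm x *\<^sub>R e)"
proof -
  have "norm x *\<^sub>R e \<in> cball 0 1" "norm x = norm (norm x *\<^sub>R e)" using assms(2,3) by simp_all
  then show ?thesis using assms(1,3) unfolding radially_symmetric_def by blast
qed

context mems_problem
begin

lemma subsolution_decreasing_load: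
  fixes s :: "'b::euclidean_space \<Rightarrow> real"
  assumes "radial_classical_subsolution J g B T l s" "0 \<le> k" "k \<le> l"
  shows "radial_classical_subsolution J g B T k s"
  unfolding radial_classical_subsolution_def
proof (intro conjI ballI)
  fix x :: 'b assume x: "x \<in> ball 0 1"
  then have "x \<in> cball 0 1" by simp
  then have "s x \<in> J" using assms(1) unfolding radial_classical_subsolution_def by blast
  then have "k * g (s x) \<le> l * g (s x)" using g_nonneg mult_right_mono[OF assms(3)] by blast
  moreover have "B * bilaplacian s x - T * laplacian s x \<le> - l * g (s x)"
    using assms(1) x unfolding radial_classical_subsolution_def by blast
  ultimately show "B * bilaplacian s x - T * laplacian s x \<le> - k * g (s x)" by simp
qed (use assms(1) in \<open>simp_all add: radial_classical_subsolution_def\<close>)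

lemma solution_plate:
  fixes u :: "'a::euclidean_space \<Rightarrow> real"
  assumes n: "n = DIM('a) - 1" and e: "e \<in> Basis"
    and u: "radially_symmetric u" "classical_solution J g B T l u"
  shows "plate n B T (\<lambda>r. B * bilaplacian u (r *\<^sub>R e) - T * laplacian u (r *\<^sub>R e)) (\<lambda>r. u (r *\<^sub>R e))"
  using u unfolding classical_solution_def n by (intro classical_plate[OF e B]) simp_all

text \<open>Since g \<open>\<ge>\<close> 0, the right-hand side is non-positive and comparison gives s \<open>\<le>\<close> 0. Then g(s) \<open>\<ge>\<close> g(0) > 0,
  so the right-hand side is even negative and s < 0 inside the ball.\<close>
lemma subsolution_plate:
  fixes s :: "'a::euclidean_space \<Rightarrow> real"
  assumes n: "n = DIM('a) - 1" and e: "e \<in> Basis" and l: "0 < l"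
    and s: "radial_classical_subsolution J g B T l s"
  obtains f where "plate n B T f (\<lambda>r. s (r *\<^sub>R e))"
    "\<And>r. r \<in> {0<..<1} \<Longrightarrow> f r \<le> - l * g (s (r *\<^sub>R e))"
    "\<And>r. r \<in> {0..1} \<Longrightarrow> s (r *\<^sub>R e) \<in> J"
    "\<And>r. r \<in> {0..1} \<Longrightarrow> s (r *\<^sub>R e) \<le> 0"
    "\<And>r. r \<in> {0..<1} \<Longrightarrow> s (r *\<^sub>R e) < 0"
proof -
  have norm_e: "norm e = 1" using e by simp
  define f where "f r = B * bilaplacian s (r *\<^sub>R e) - T * laplacian s (r *\<^sub>R e)" for r
  have p: "plate n B T f (\<lambda>r. s (r *\<^sub>R e))"
    using s unfolding radial_classical_subsolution_def f_def n by (intro classical_plate[OF e B]) simp_all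
  have f: "f r \<le> - l * g (s (r *\<^sub>R e))" if "r \<in> {0<..<1}" for r
  proof -
    have "r *\<^sub>R e \<in> ball 0 1" using that norm_e by simp
    then show ?thesis using s unfolding radial_classical_subsolution_def f_def by blast
  qed
  have sJ: "s (r *\<^sub>R e) \<in> J" if "r \<in> {0..1}" for r
  proof -
    have "r *\<^sub>R e \<in> cball 0 1" using that norm_e by simp
    then show ?thesis using s unfolding radial_classical_subsolution_def by blast
  qed
  have f0: "f r \<le> 0" if "r \<in> {0<..<1}" for r
  proof -
    have "0 \<le> l * g (s (r *\<^sub>R e))" using g_nonneg sJ[of r] l that by simp
    with f[OF that] show ?thesis by simp
  qed
  have s0: "s (r *\<^sub>R e) \<le> 0" if "r \<in> {0..1}" for r
    by (rule plate_nonpos[OF B T p f0 that])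
  have "f r < 0" if "r \<in> {0<..<1}" for r
  proof -
    have r: "r \<in> {0..1}" using that by auto
    have "0 < l * g (s (r *\<^sub>R e))" using g_le[OF sJ[OF r] J(3) s0[OF r]] g0 l by simp
    with f[OF that] show ?thesis by simp
  qed
  then have "s (r *\<^sub>R e) < 0" if "r \<in> {0..<1}" for r
    using plate_neg[OF B T p _ that] by blast
  with p f sJ s0 show thesis by (rule that)
qed

lemma subsolution_trace:
  fixes s :: "'a::euclidean_space \<Rightarrow> real"
  assumes n: "n = DIM('a) - 1" and e: "e \<in> Basis" and l: "0 < l"
    and s: "radial_classical_subsolution J g B T l s"
  shows "subsolution_1d l (\<lambda>t. s (sqrt t *\<^sub>R e))"
proof -
  obtain f where p: "plate n B T f (\<lambda>r. s (r *\<^sub>R e))"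
    and f: "\<And>r. r \<in> {0<..<1} \<Longrightarrow> f r \<le> - l * g (s (r *\<^sub>R e))"
    and sJ: "\<And>r. r \<in> {0..1} \<Longrightarrow> s (r *\<^sub>R e) \<in> J"
    and s0: "\<And>r. r \<in> {0..1} \<Longrightarrow> s (r *\<^sub>R e) \<le> 0"
    and "\<And>r. r \<in> {0..<1} \<Longrightarrow> s (r *\<^sub>R e) < 0"
    by (rule subsolution_plate[OF n e l s]) (rule that)
  have sq: "sqrt t \<in> {0..1}" if "t \<in> {0..1}" for t using that by simp
  have c: "continuous_on {0..1} (\<lambda>t. s (sqrt t *\<^sub>R e))"
    by (rule continuous_on_compose2[OF plate_continuous[OF p]]) (auto intro!: continuous_intros)
  have "s (sqrt t *\<^sub>R e) \<le> green (load l (\<lambda>t. s (sqrt t *\<^sub>R e))) t" if t: "t \<in> {0..1}" for t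
  proof -
    have "s (sqrt t *\<^sub>R e) \<le> green (load l (\<lambda>t. s (sqrt t *\<^sub>R e))) ((sqrt t)\<^sup>2)"
    proof (rule plate_le_green[OF p load_continuous[OF c sJ[OF sq]] _ sq[OF t]], assumption)
      show "f r \<le> - l * g (s (sqrt (r\<^sup>2) *\<^sub>R e))" if "r \<in> {0<..<1}" for r
        using f[OF that] that by simp
    qed
    then show ?thesis using t by simp
  qed
  then show ?thesis using c sJ[OF sq] s0[OF sq] by (simp add: subsolution_1d_def)
qed

text \<open>Bootstrapping: U continuous makes its load continuous, hence U is C^2 in t; as g is C^2 the load is
  then C^2 as well, and U is C^4.\<close>
lemma fixed_point_classical_solution:
  assumes n: "n = DIM('a::euclidean_space) - 1"
    and U: "subsolution_1d l U" and fixed: "\<And>t. t \<in> {0..1} \<Longrightarrow> U t = green (load l U) t"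
  defines "u \<equiv> \<lambda>x::'a. green (load l U) (x \<bullet> x)"
  shows "classical_solution J g B T l u"
proof -
  have d: "real n + 1 = real DIM('a)" using n DIM_positive[where 'a='a] by (simp add: of_nat_diff)
  define f where "f = load l U"
  have UJ: "U t \<in> J" if "t \<in> {0..1}" for t using U that by (simp add: subsolution_1d_def)
  have UV: "U t = green f t" if "t \<in> {0..1}" for t using fixed[OF that] by (simp add: f_def)
  have reg: "Ck k f \<Longrightarrow> Ck (Suc (Suc k)) U" for k
    by (rule Ck_cong[OF UV[symmetric] green_Ck])
  have load_reg: "Ck k f" if "Ck k U" "C_on k J g" for k
    unfolding f_def by (rule Ck_mult[OF Ck_const Ck_compose[OF that(2,1) UJ]])
  have "continuous_on {0..1} U" using U by (simp add: subsolution_1d_def)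
  then have "Ck 0 f" unfolding f_def Ck.simps by (rule load_continuous[OF _ UJ])
  from reg[OF this] have f2: "Ck 2 f" using load_reg g by (simp only: numeral_2_eq_2)
  have f1: "Ck 1 f" using Ck_SucD[of 1 f] f2 by (simp only: Suc_1)
  have "Suc (Suc 2) = 4" by simp
  then have V4: "Ck 4 (green f)" using green_Ck[OF f2] by (simp only:)
  have V2: "Ck 2 (green f)" by (rule Ck_SucD[OF Ck_SucD[OF green_Ck[OF f2]]])
  obtain u1 u2 w1 w2 where
    u1: "\<And>t. t \<in> {0..1} \<Longrightarrow> (green f has_real_derivative u1 t) (at t within {0..1})"
    and u2: "\<And>t. t \<in> {0..1} \<Longrightarrow> (u1 has_real_derivative u2 t) (at t within {0..1})"
    and ou: "\<And>t. t \<in> {0..1} \<Longrightarrow> 4 * t * u2 t + 2 * (real n + 1) * u1 t = green_lap f t"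
    and w1: "\<And>t. t \<in> {0..1} \<Longrightarrow> (green_lap f has_real_derivative w1 t) (at t within {0..1})"
    and w2: "\<And>t. t \<in> {0..1} \<Longrightarrow> (w1 has_real_derivative w2 t) (at t within {0..1})"
    and ow: "\<And>t. t \<in> {0..1} \<Longrightarrow> 4 * t * w2 t + 2 * (real n + 1) * w1 t = (T * green_lap f t + f t) / B"
    and u1_end: "u1 1 = 0"
    by (rule green_ode[OF f1]) (rule that)
  have u: "u = (\<lambda>x. green f (x \<bullet> x))" by (simp add: u_def f_def)
  have sq: "x \<bullet> x \<in> {0..1}" if "x \<in> cball 0 1" for x :: 'a
    using that by (simp add: dot_square_norm power_le_one)
  have lap: "laplacian u x = green_lap f (x \<bullet> x)" if x: "x \<in> ball 0 1" for x
  proof -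
    have "laplacian u x = 4 * (x \<bullet> x) * u2 (x \<bullet> x) + 2 * real DIM('a) * u1 (x \<bullet> x)"
      unfolding u by (rule radial_laplacian[OF u1 u2 x])
    then show ?thesis using ou[OF sq[of x]] x d by simp
  qed
  have bilap: "bilaplacian u x = (T * green_lap f (x \<bullet> x) + f (x \<bullet> x)) / B" if x: "x \<in> ball 0 1" for x
  proof -
    have "bilaplacian u x = laplacian (\<lambda>x. green_lap f (x \<bullet> x)) x"
      unfolding bilaplacian_def by (rule laplacian_cong[OF open_ball x lap])
    also have "\<dots> = 4 * (x \<bullet> x) * w2 (x \<bullet> x) + 2 * real DIM('a) * w1 (x \<bullet> x)"
      by (rule radial_laplacian[OF w1 w2 x])
    finally show ?thesis using ow[OF sq[of x]] x d by simp
  qed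
  show ?thesis
    unfolding classical_solution_def
  proof (intro conjI ballI)
    show "C_on 4 (ball 0 1) u" unfolding u by (rule radial_C_on[OF V4])
    show "C_closure 2 (ball 0 1) u" unfolding u by (rule radial_C_closure[OF V2])
    show "u ` cball 0 1 \<subseteq> J" using UJ[OF sq] UV[OF sq] by (auto simp: u)
    show "B * bilaplacian u x - T * laplacian u x = - l * g (u x)" if x: "x \<in> ball 0 1" for x
    proof -
      have "u x = U (x \<bullet> x)" using UV[OF sq[of x]] x by (simp add: u)
      then have "f (x \<bullet> x) = - l * g (u x)" by (simp add: f_def)
      then show ?thesis unfolding lap[OF x] bilap[OF x] using B by simp
    qed
    show "clamped u"
      unfolding clamped_def has_normal_derivative_def
    proof (intro ballI conjI)
      fix x :: 'a assume "x \<in> sphere 0 1"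
      then have x: "x \<bullet> x = 1" by (simp add: dot_square_norm)
      show "u x = 0" using x by (simp add: u green_def)
      \<comment> \<open>Near 0 the half-line may be cut to [-1, 0], where |x + t x|^2 = (1 + t)^2 stays in the unit interval.\<close>
      have "(green f has_real_derivative 0) (at ((1 + 0)\<^sup>2) within (\<lambda>t. (1 + t)\<^sup>2) ` {-1..0})"
      proof (rule DERIV_subset)
        show "(green f has_real_derivative 0) (at ((1 + 0)\<^sup>2) within {0..1})"
          using u1[of 1] u1_end by simp
        show "(\<lambda>t. (1 + t)\<^sup>2) ` {-1..0::real} \<subseteq> {0..1}" by (auto simp: power_le_one)
      qed
      moreover have "((\<lambda>t. (1 + t)\<^sup>2) has_real_derivative 2) (at 0 within {-1..0})"
        by (auto intro!: derivative_eq_intros)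
      ultimately have "(green f \<circ> (\<lambda>t. (1 + t)\<^sup>2) has_real_derivative 0 * 2) (at 0 within {-1..0})"
        by (rule DERIV_image_chain)
      moreover have "at 0 within {-1..0} = at 0 within {..0::real}"
        by (rule at_within_nhd[of _ "{-1<..}"]) auto
      moreover have "(x + t *\<^sub>R x) \<bullet> (x + t *\<^sub>R x) = (1 + t)\<^sup>2" for t
        using x by (simp add: inner_add_left inner_add_right power2_eq_square algebra_simps)
      ultimately show "((\<lambda>t. u (x + t *\<^sub>R x)) has_real_derivative 0) (at 0 within {..0})"
        by (simp add: u o_def)
    qed
  qed
qed

lemma maximal_solution_exists:
  assumes n: "n = DIM('a::euclidean_space) - 1" and l: "0 < l" and s: "subsolution_1d l s"
  shows "\<exists>u :: 'a \<Rightarrow> real. nonpositive_maximal_solution J g B T l u"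
proof -
  have l0: "0 \<le> l" using l by simp
  obtain U where U: "subsolution_1d l U" and fixed: "\<And>t. t \<in> {0..1} \<Longrightarrow> U t = green (load l U) t"
    and greatest: "\<And>v t. subsolution_1d l v \<Longrightarrow> t \<in> {0..1} \<Longrightarrow> v t \<le> U t"
    by (rule maximal_subsolution_1d[OF l0 s]) (rule that)
  obtain e :: 'a where e: "e \<in> Basis" using nonempty_Basis by blast
  define u where "u x = green (load l U) (x \<bullet> x)" for x :: 'a
  have sol: "classical_solution J g B T l u"
    unfolding u_def[abs_def] by (rule fixed_point_classical_solution[OF n U fixed])
  have sq: "x \<bullet> x \<in> {0..1}" if "x \<in> cball 0 1" for x :: 'a
    using that by (simp add: dot_square_norm power_le_one)
  have uU: "u x = U (x \<bullet> x)" if "x \<in> cball 0 1" for x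
    using fixed[OF sq[OF that]] by (simp add: u_def)
  have "radially_symmetric u" by (simp add: radially_symmetric_def u_def dot_square_norm)
  moreover have "s x \<le> u x" if s: "radial_classical_subsolution J g B T l s" and x: "x \<in> ball 0 1" for s x
  proof -
    have xc: "x \<in> cball 0 1" using x by simp
    have "s (sqrt (x \<bullet> x) *\<^sub>R e) \<le> U (x \<bullet> x)"
      by (rule greatest[OF subsolution_trace[OF n e l s] sq[OF xc]])
    moreover have "s x = s (sqrt (x \<bullet> x) *\<^sub>R e)"
      using radially_symmetric_axis[of s e x] s e xc
      by (simp add: radial_classical_subsolution_def flip: norm_eq_sqrt_inner)
    ultimately show ?thesis using uU[OF xc] by simp
  qed
  moreover have "u x \<le> 0" if "x \<in> cball 0 1" for x
    using uU[OF that] U sq[OF that] by (simp add: subsolution_1d_def)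
  ultimately show ?thesis
    using sol unfolding nonpositive_maximal_solution_def maximal_solution_def by blast
qed

text \<open>The solution for the larger load is a subsolution for the smaller one, hence v \<open>\<le>\<close> u. Then
  l2 g(v) \<open>\<ge>\<close> l2 g(u) > l1 g(u), and the strict comparison principle applies to v - u.\<close>
lemma maximal_solution_strictly_decreasing:
  fixes u v :: "'a::euclidean_space \<Rightarrow> real"
  assumes n: "n = DIM('a) - 1" and l: "0 < l1" "l1 < l2"
    and u: "nonpositive_maximal_solution J g B T l1 u" and v: "nonpositive_maximal_solution J g B T l2 v"
    and x: "x \<in> ball 0 1"
  shows "v x < u x"
proof -
  obtain e :: 'a where e: "e \<in> Basis" using nonempty_Basis by blast
  have norm_e: "norm e = 1" using e by simp
  have ru: "radially_symmetric u" "classical_solution J g B T l1 u"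
    and rv: "radially_symmetric v" "classical_solution J g B T l2 v"
    using u v by (auto simp: nonpositive_maximal_solution_def maximal_solution_def)
  have "radial_classical_subsolution J g B T l1 v"
    using subsolution_decreasing_load[OF solution_imp_subsolution[OF rv], of l1] l by simp
  then have vu: "v y \<le> u y" if "y \<in> ball 0 1" for y
    using u that by (simp add: nonpositive_maximal_solution_def maximal_solution_def)
  have pu: "plate n B T (\<lambda>r. B * bilaplacian u (r *\<^sub>R e) - T * laplacian u (r *\<^sub>R e)) (\<lambda>r. u (r *\<^sub>R e))"
    and pv: "plate n B T (\<lambda>r. B * bilaplacian v (r *\<^sub>R e) - T * laplacian v (r *\<^sub>R e)) (\<lambda>r. v (r *\<^sub>R e))"
    using solution_plate[OF n e ru] solution_plate[OF n e rv] .
  have "v (norm x *\<^sub>R e) - u (norm x *\<^sub>R e) < 0"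
  proof (rule plate_neg[OF B T plate_diff[OF pv pu]])
    fix r :: real assume r: "r \<in> {0<..<1}"
    let ?y = "r *\<^sub>R e"
    have y: "?y \<in> ball 0 1" "?y \<in> cball 0 1" using r norm_e by auto
    have J': "v ?y \<in> J" "u ?y \<in> J" using ru rv y(2) unfolding classical_solution_def by blast+
    have "u ?y \<le> 0" using u y(2) by (simp add: nonpositive_maximal_solution_def)
    then have "0 < g (u ?y)" using g_le[OF J'(2) J(3)] g0 by simp
    then have "l1 * g (u ?y) < l2 * g (u ?y)" using l by simp
    also have "\<dots> \<le> l2 * g (v ?y)" using g_le[OF J' vu[OF y(1)]] l by simp
    finally show "(B * bilaplacian v ?y - T * laplacian v ?y) - (B * bilaplacian u ?y - T * laplacian u ?y) < 0"
      using ru(2) rv(2) y(1) unfolding classical_solution_def by simp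
  qed (use x in simp)
  then show ?thesis
    using radially_symmetric_axis[OF ru(1) e, of x] radially_symmetric_axis[OF rv(1) e, of x] x by simp
qed

text \<open>A subsolution satisfies g(s) \<open>\<ge>\<close> m, hence s \<open>\<le>\<close> l m Green(-1) by comparison. At the centre Green(-1) is a
  negative number \<open>\<psi>\<close>, so inf J < l m \<open>\<psi>\<close>, which bounds l.\<close>
lemma load_bounded:
  assumes n: "n = DIM('a::euclidean_space) - 1" and bdd: "bdd_below J" and m: "0 < (INF s\<in>{Inf J<..<0}. g s)"
  shows "\<exists>b. \<forall>l>0. \<forall>s :: 'a \<Rightarrow> real. radial_classical_subsolution J g B T l s \<longrightarrow> l \<le> b"
proof -
  define m where "m = (INF s\<in>{Inf J<..<0}. g s)"
  have inJ: "s \<in> J" if s: "Inf J < s" "s \<le> 0" for s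
  proof -
    have "J \<noteq> {}" using J(3) by blast
    from cInf_lessD[OF this s(1)] obtain a where a: "a \<in> J" "a < s" by blast
    show ?thesis using mem_is_interval_1_I[OF J(2) a(1) J(3)] a(2) s(2) by simp
  qed
  have "bdd_below (g ` {Inf J<..<0})"
    using g_nonneg inJ by (intro bdd_belowI2[of _ 0]) auto
  then have gm: "m \<le> g s" if "s \<in> {Inf J<..<0}" for s
    unfolding m_def using that by (rule cINF_lower)
  define \<psi> where "\<psi> = green (\<lambda>_. - 1) 0"
  have p1: "plate n B T (\<lambda>r. - 1) (\<lambda>r. green (\<lambda>_. - 1) (r\<^sup>2))"
    by (rule green_plate) simp
  have \<psi>: "\<psi> < 0" using plate_neg[OF B T p1, of 0] by (simp add: \<psi>_def)
  have "l \<le> Inf J / (m * \<psi>)"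
    if l: "0 < l" and s: "radial_classical_subsolution J g B T l s" for l and s :: "'a \<Rightarrow> real"
  proof -
    obtain e :: 'a where e: "e \<in> Basis" using nonempty_Basis by blast
    obtain f where p: "plate n B T f (\<lambda>r. s (r *\<^sub>R e))"
      and f: "\<And>r. r \<in> {0<..<1} \<Longrightarrow> f r \<le> - l * g (s (r *\<^sub>R e))"
      and sJ: "\<And>r. r \<in> {0..1} \<Longrightarrow> s (r *\<^sub>R e) \<in> J"
      and "\<And>r. r \<in> {0..1} \<Longrightarrow> s (r *\<^sub>R e) \<le> 0"
      and neg: "\<And>r. r \<in> {0..<1} \<Longrightarrow> s (r *\<^sub>R e) < 0"
      by (rule subsolution_plate[OF n e l s]) (rule that)
    have "s (0 *\<^sub>R e) \<le> l * m * green (\<lambda>_. - 1) (0\<^sup>2)"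
    proof (rule plate_le[OF B T p plate_scale[OF p1]])
      fix r :: real assume r: "r \<in> {0<..<1}"
      then have "s (r *\<^sub>R e) \<in> {Inf J<..<0}"
        using open_above_Inf[OF J(1) bdd sJ[of r]] neg[of r] by simp
      then have "l * m \<le> l * g (s (r *\<^sub>R e))" using gm l by simp
      with f[OF r] show "f r \<le> l * m * - 1" by simp
    qed simp
    moreover have "Inf J < s (0 *\<^sub>R e)" by (rule open_above_Inf[OF J(1) bdd sJ]) simp
    ultimately have "Inf J \<le> l * (m * \<psi>)" by (simp add: \<psi>_def)
    moreover have "m * \<psi> < 0" using m \<psi> by (simp add: m_def mult_pos_neg)
    ultimately show ?thesis by (simp add: neg_le_divide_eq)
  qed
  then show ?thesis by blast
qed

end

theorem theorem1p5:
  fixes J :: "real set" and g :: "real \<Rightarrow> real" and B T :: real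
  assumes "open J" and "is_interval J" and "0 \<in> J"
    and "C_on 2 J g"
    and "\<forall>s\<in>J. 0 \<le> g s"
    and "antimono_on J g"
    and "0 < g 0"
    and "0 < B" and "0 < T"
  shows "\<exists>(L::ereal) (u :: real \<Rightarrow> real ^ 'n \<Rightarrow> real).
     0 < L \<and>
     (\<forall>l. 0 < l \<and> ereal l < L \<longrightarrow>
        nonpositive_maximal_solution J g B T l (u l) \<and>
        (\<forall>v. nonpositive_maximal_solution J g B T l v \<longrightarrow> (\<forall>x\<in>cball 0 1. v x = u l x))) \<and>
     (L < \<infinity> \<longrightarrow>
        (\<forall>l. L < ereal l \<longrightarrow>
           \<not> (\<exists>v :: real ^ 'n \<Rightarrow> real. radially_symmetric v \<and> classical_solution J g B T l v))) \<and>
     (\<forall>x\<in>ball 0 1. \<forall>l1 l2. 0 < l1 \<and> l1 < l2 \<and> ereal l2 < L \<longrightarrow> u l2 x < u l1 x) \<and>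
     (bdd_below J \<and> (INF s\<in>{Inf J<..<0}. g s) > 0 \<longrightarrow> L < \<infinity>)"
proof -
  define n where "n = DIM(real ^ 'n) - 1"
  interpret mems_problem n B T J g
    by standard (use assms in auto)
  note n = n_def
  define \<Lambda> where "\<Lambda> = {l. 0 < l \<and> (\<exists>s :: real ^ 'n \<Rightarrow> real. radial_classical_subsolution J g B T l s)}"
  define L where "L = (SUP l\<in>\<Lambda>. ereal l)"
  define u where "u l = (SOME u :: real ^ 'n \<Rightarrow> real. nonpositive_maximal_solution J g B T l u)" for l
  obtain e :: "real ^ 'n" where e: "e \<in> Basis" using nonempty_Basis by blast
  have sol_\<Lambda>: "l \<in> \<Lambda>" if "0 < l" "radially_symmetric v" "classical_solution J g B T l v"
    for l and v :: "real ^ 'n \<Rightarrow> real"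
    using solution_imp_subsolution[OF that(2,3)] that(1) by (auto simp: \<Lambda>_def)
  have below: "l \<in> \<Lambda>" if l: "0 < l" "ereal l < L" for l
  proof -
    obtain k where k: "k \<in> \<Lambda>" "l < k" using l(2) by (auto simp: L_def less_SUP_iff)
    then show ?thesis using l(1) subsolution_decreasing_load[of k _ l] by (auto simp: \<Lambda>_def)
  qed
  have max: "nonpositive_maximal_solution J g B T l (u l)" if l: "0 < l" "ereal l < L" for l
  proof -
    obtain s :: "real ^ 'n \<Rightarrow> real" where "radial_classical_subsolution J g B T l s"
      using below[OF l] by (auto simp: \<Lambda>_def)
    from maximal_solution_exists[OF n l(1) subsolution_trace[OF n e l(1) this]]
    show ?thesis unfolding u_def by (rule someI_ex)
  qed
  have L_pos: "0 < L"
  proof -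
    obtain l s where l: "0 < l" "subsolution_1d l s" using small_load_subsolution by blast
    obtain v :: "real ^ 'n \<Rightarrow> real" where "nonpositive_maximal_solution J g B T l v"
      using maximal_solution_exists[OF n l] by blast
    then have "l \<in> \<Lambda>"
      using sol_\<Lambda>[OF l(1)] by (auto simp: nonpositive_maximal_solution_def maximal_solution_def)
    then have "ereal l \<le> L" unfolding L_def by (rule SUP_upper)
    moreover have "0 < ereal l" using l(1) by simp
    ultimately show ?thesis by (rule less_le_trans[rotated])
  qed
  have unique: "v x = u l x" if l: "0 < l" "ereal l < L"
    and v: "nonpositive_maximal_solution J g B T l v" and x: "x \<in> cball 0 1" for l v x
  proof -
    have u: "nonpositive_maximal_solution J g B T l (u l)" by (rule max[OF l])
    have 1: "radially_symmetric v" "classical_solution J g B T l v"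
        "radially_symmetric (u l)" "classical_solution J g B T l (u l)"
      using u v by (auto simp: nonpositive_maximal_solution_def maximal_solution_def)
    show ?thesis
    proof (cases "x \<in> ball 0 1")
      case True
      then show ?thesis
        using u v solution_imp_subsolution[OF 1(1,2)] solution_imp_subsolution[OF 1(3,4)]
        unfolding nonpositive_maximal_solution_def maximal_solution_def by (blast intro: order_antisym)
    next
      case False
      then have "x \<in> sphere 0 1" using x by simp
      then show ?thesis using 1(2,4) by (simp add: classical_solution_def clamped_def)
    qed
  qed
  have none: "\<not> (\<exists>v :: real ^ 'n \<Rightarrow> real. radially_symmetric v \<and> classical_solution J g B T l v)"
    if l: "L < ereal l" for l
  proof
    assume "\<exists>v :: real ^ 'n \<Rightarrow> real. radially_symmetric v \<and> classical_solution J g B T l v"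
    then obtain v :: "real ^ 'n \<Rightarrow> real" where v: "radially_symmetric v" "classical_solution J g B T l v"
      by blast
    have "0 < ereal l" using less_trans[OF L_pos l] .
    then have "l \<in> \<Lambda>" using sol_\<Lambda>[OF _ v] by simp
    then have "ereal l \<le> L" unfolding L_def by (rule SUP_upper)
    with l show False by simp
  qed
  have decreasing: "u l2 x < u l1 x" if "x \<in> ball 0 1" "0 < l1" "l1 < l2" "ereal l2 < L" for x l1 l2
  proof -
    have "ereal l1 < L" using less_trans[of "ereal l1" "ereal l2" L] that by simp
    moreover have "0 < l2" using that by simp
    ultimately show ?thesis
      using maximal_solution_strictly_decreasing[OF n that(2,3) max max that(1)] that by blast
  qed
  have finite: "L < \<infinity>" if bdd: "bdd_below J \<and> (INF s\<in>{Inf J<..<0}. g s) > 0"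
  proof -
    have "bdd_below J" "0 < (INF s\<in>{Inf J<..<0}. g s)" using bdd by simp_all
    from load_bounded[OF n this] obtain b where
      b: "\<forall>l>0. \<forall>s :: real ^ 'n \<Rightarrow> real. radial_classical_subsolution J g B T l s \<longrightarrow> l \<le> b"
      by (rule exE)
    have "ereal l \<le> ereal b" if "l \<in> \<Lambda>" for l
      using that b unfolding \<Lambda>_def by auto
    then have "L \<le> ereal b" unfolding L_def by (rule SUP_least)
    also have "\<dots> < \<infinity>" by simp
    finally show ?thesis .
  qed
  show ?thesis
  proof (intro exI[of _ L] exI[of _ u] conjI allI impI ballI)
    show "0 < L" by (rule L_pos)
    show "nonpositive_maximal_solution J g B T l (u l)" if "0 < l \<and> ereal l < L" for l
      using max that by blast
    show "v x = u l x" if "0 < l \<and> ereal l < L" "nonpositive_maximal_solution J g B T l v" "x \<in> cball 0 1"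
      for l v x using unique that by blast
    show "\<not> (\<exists>v :: real ^ 'n \<Rightarrow> real. radially_symmetric v \<and> classical_solution J g B T l v)"
      if "L < ereal l" for l by (rule none[OF that])
    show "u l2 x < u l1 x" if "x \<in> ball 0 1" "0 < l1 \<and> l1 < l2 \<and> ereal l2 < L" for x l1 l2
      using decreasing that by blast
    show "L < \<infinity>" if "bdd_below J \<and> (INF s\<in>{Inf J<..<0}. g s) > 0"
      by (rule finite[OF that])
  qed
qed

end
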